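(* Let $m\ge1$, $1\leq p<2$, $0\le\alpha\le1$, $\nu\in\{0,1,2,\dots\}$, and let $\varphi\in C^{\nu,\alpha}(\mathbb T^m)$ be a real function such that $\nabla\varphi(\mathbb T^m)$ has positive Lebesgue measure. Suppose $\nu+\alpha\geq2$ and $\nu+\alpha>m(1/p-1/2)$. Then $$\|e^{i\lambda\varphi}\|_{A_p(\mathbb T^m)}\simeq|\lambda|^{m(1/p-1/2)},\qquad |\lambda|\to\infty,\ \lambda\in\mathbb R.$$ In particular, if $\nu+\alpha\ge2$ and $\nu+\alpha>m/2$, then $\|e^{i\lambda\varphi}\|_{A_1(\mathbb T^m)}\simeq|\lambda|^{m/2}$.
   Context: $\mathbb T^m=\mathbb R^m/2\pi\mathbb Z^m$; functions on $\mathbb T^m$ are identified with $2\pi$-periodic functions on $\mathbb R^m$. $\widehat f(k)=(2\pi)^{-m}\int_{\mathbb T^m}f(t)e^{-i(k,t)}dt$; $A_1(\mathbb T^m)$ is the space of continuous $f$ with $\widehat f\in l^1(\mathbb Z^m)$, for $1<p\le2$ $A_p(\mathbb T^m)$ is the space of integrable $f$ with $\widehat f\in l^p$; $\|f\|_{A_p(\mathbb T^m)}=\|\widehat f\|_{l^p(\mathbb Z^m)}$. For $0<\alpha\le1$, $C^{\nu,\alpha}(\mathbb T^m)$ is the class of $\nu$ times differentiable functions all of whose partial derivatives of order $\nu$ (for $\nu=0$, the function itself) satisfy a Lipschitz condition of order $\alpha$; $C^{\nu,0}=C^\nu$. $a(\lambda)\simeq b(\lambda)$ means $c_1\le a(\lambda)/b(\lambda)\le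 c_2$ for all sufficiently large $|\lambda|$ with constants $c_1,c_2>0$ independent of $\lambda$. *)

theory Defs
  imports "HOL-Analysis.Analysis"
begin

text \<open>Functions on the torus T^m are 2pi-periodic functions on R^m, R^m = real^'m, m = CARD('m).\<close>

definition torus_periodic :: "(real^'m \<Rightarrow> 'b) \<Rightarrow> bool" where
  "torus_periodic f \<longleftrightarrow> (\<forall>x i. f (x + (2 * pi) *\<^sub>R axis i 1) = f x)"

definition partial_deriv :: "'m \<Rightarrow> (real^'m \<Rightarrow> real) \<Rightarrow> real^'m \<Rightarrow> real" where
  "partial_deriv i f x = frechet_derivative f (at x) (axis i 1)"

definition gradient_vec :: "(real^'m \<Rightarrow> real) \<Rightarrow> real^'m \<Rightarrow> real^'m" where
  "gradient_vec f x = (\<chi> i. partial_deriv i f x)"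

definition lipschitz_order :: "real \<Rightarrow> (real^'m \<Rightarrow> real) \<Rightarrow> bool" where
  "lipschitz_order \<alpha> g \<longleftrightarrow> (\<exists>C. \<forall>x y. \<bar>g x - g y\<bar> \<le> C * dist x y powr \<alpha>)"

text \<open>C^{nu,alpha}: nu times differentiable, all partials of order nu Lipschitz of order alpha;
  for alpha = 0 the order-nu partials are continuous, i.e. C^{nu,0} = C^nu.\<close>
fun holder_class :: "nat \<Rightarrow> real \<Rightarrow> (real^'m \<Rightarrow> real) \<Rightarrow> bool" where
  "holder_class 0 \<alpha> f = (if \<alpha> = 0 then continuous_on UNIV f else lipschitz_order \<alpha> f)"
| "holder_class (Suc n) \<alpha> f =
     ((\<forall>x. f differentiable (at x)) \<and> (\<forall>i. holder_class n \<alpha> (partial_deriv i f)))"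

definition fourier_coeff :: "(real^'m \<Rightarrow> complex) \<Rightarrow> int^'m \<Rightarrow> complex" where
  "fourier_coeff f k = complex_of_real ((2 * pi) powr (- real CARD('m))) *
     integral (cbox 0 (\<chi> i. 2 * pi))
       (\<lambda>t. f t * exp (- \<i> * complex_of_real (\<Sum>i\<in>UNIV. real_of_int (k $ i) * t $ i)))"

text \<open>A_p norm = l^p norm of the Fourier coefficients (p >= 1). Meaningful when the
  family is summable; the theorem asserts summability explicitly.\<close>
definition Ap_summable :: "real \<Rightarrow> (real^'m \<Rightarrow> complex) \<Rightarrow> bool" where
  "Ap_summable p f \<longleftrightarrow> (\<lambda>k. norm (fourier_coeff f k) powr p) summable_on UNIV"

definition Ap_norm :: "real \<Rightarrow> (real^'m \<Rightarrow> complex) \<Rightarrow> real" where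
  "Ap_norm p f = (\<Sum>\<^sub>\<infinity>k. norm (fourier_coeff f k) powr p) powr (1 / p)"

end

theory Submission
  imports Defs
begin

text \<open>
  Upper bound: with \<open>D\<close> the difference operator with step \<open>h\<close> in a coordinate direction,
  \<open>D\<^sup>\<nu>\<^sup>+\<^sup>1 exp (\<i>\<lambda>\<phi>)\<close> is \<open>O((\<bar>\<lambda>\<bar> h)\<^sup>s)\<close> for \<open>s = \<nu> + \<alpha>\<close>. Bessel's inequality with \<open>h = 1 / (2\<^sup>j \<bar>\<lambda>\<bar>)\<close> then bounds
  the square sum of the coefficients over the shell of frequencies of size \<open>2\<^sup>j \<bar>\<lambda>\<bar>\<close> by
  \<open>O(2\<^sup>-\<^sup>2\<^sup>j\<^sup>s)\<close>. Passing from \<open>l\<^sup>2\<close> to \<open>l\<^sup>p\<close> on each shell gives a geometric series, convergent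
  since \<open>s > m (1/p - 1/2)\<close>.

  Lower bound: near a point \<open>t\<^sub>0\<close>, at scale \<open>\<bar>\<lambda>\<bar>\<close> to the power \<open>-1/2\<close>, the function
  \<open>exp (\<i>\<lambda>\<phi>)\<close> is close to a plane wave whose frequency \<open>k\<close> is the integer part of
  \<open>\<lambda>\<nabla>\<phi>(t\<^sub>0)\<close>. Testing against a nonnegative trigonometric kernel concentrated at this
  scale, whose coefficients do not depend on \<open>t\<^sub>0\<close> up to unimodular factors, shows that a fixed
  convolution of the absolute values of the coefficients is bounded below at \<open>k\<close>. Since the
  range of the gradient has positive measure, this happens for at least a multiple of \<open>\<bar>\<lambda>\<bar>\<^sup>m\<close> many
  \<open>k\<close>, and an \<open>l\<^sup>p\<close> count finishes the proof.
\<close>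

section \<open>Fourier coefficients on the torus\<close>

text \<open>With m coordinates and L = \<bar>\<lambda>\<bar>, put \<beta> = m (1 - p/2), so that
  \<beta> / p is the exponent to be proved. A shell holds O((2^j L)^m) frequencies, so its p-th
  powers sum to O(L^\<beta> 2^(j (\<beta> - s p))); the assumption on s says exactly that \<beta> <
  s p. For the lower bound, s \<ge> 2 makes the gradient Lipschitz, so linearising the phase at t0
  costs O(L d^2) at distance d. This fixes the scale 1/M with M of order L^(1/2). The kernel is the
  squared modulus of a polynomial with coefficients of size M on a cube of side of order M: its mean
  is of order M^(m+2), its second moments are smaller by a factor M^2, and both come from Parseval's
  identity. The weights of the convolution add up to O(M^(2m+2)), so the weighted mean of the
  coefficients near k is at least of order M^(-m), that is L^(-m/2). Then L^m many k give a p-th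
  power sum of order L^m L^(-mp/2) = L^\<beta>. The base point t0 changes with k, which is why one
  set of nonnegative weights must serve all base points.\<close>

definition char_torus :: "int^'m \<Rightarrow> real^'m \<Rightarrow> complex" where
  "char_torus k t = cis (\<Sum>i\<in>UNIV. real_of_int (k $ i) * t $ i)"

definition torus_mean :: "(real^'m \<Rightarrow> 'b::real_normed_vector) \<Rightarrow> 'b" where
  "torus_mean f = ((2 * pi) powr (- real CARD('m))) *\<^sub>R integral (cbox 0 (\<chi> i. 2 * pi)) f"

lemma fourier_coeff_eq_mean: "fourier_coeff f k = torus_mean (\<lambda>t. f t * cnj (char_torus k t))"
  unfolding fourier_coeff_def torus_mean_def char_torus_def
  by (simp add: scaleR_conv_of_real cis_cnj) (simp add: cis_conv_exp)

lemma norm_char_torus [simp]: "norm (char_torus k t) = 1"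
  by (simp add: char_torus_def)

lemma char_torus_0 [simp]: "char_torus 0 t = 1" "char_torus k 0 = 1"
  by (simp_all add: char_torus_def)

lemma char_torus_add_right: "char_torus k (s + t) = char_torus k s * char_torus k t"
  by (simp add: char_torus_def cis_mult algebra_simps sum.distrib)

lemma char_torus_add_left: "char_torus (k + l) t = char_torus k t * char_torus l t"
  by (simp add: char_torus_def cis_mult algebra_simps sum.distrib)

lemma cnj_char_torus: "cnj (char_torus k t) = char_torus (- k) t"
  by (simp add: char_torus_def cis_cnj sum_negf)

lemma cnj_char_torus_right: "cnj (char_torus k t) = char_torus k (- t)"
  by (simp add: char_torus_def cis_cnj sum_negf)

lemma char_torus_axis_right:
  fixes k :: "int^'m"
  shows "char_torus k (h *\<^sub>R axis i 1) = cis (real_of_int (k $ i) * h)"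
proof -
  have "(\<Sum>j\<in>UNIV. real_of_int (k $ j) * (h *\<^sub>R axis i 1 :: real^'m) $ j)
      = (\<Sum>j\<in>UNIV. if j = i then real_of_int (k $ i) * h else 0)"
    by (rule sum.cong) (auto simp: axis_def)
  then show ?thesis by (simp add: char_torus_def)
qed

lemma char_torus_axis_left:
  fixes t :: "real^'m"
  shows "char_torus (axis i 1) t = cis (t $ i)"
proof -
  have "(\<Sum>j\<in>UNIV. real_of_int ((axis i 1 :: int^'m) $ j) * t $ j)
      = (\<Sum>j\<in>UNIV. if j = i then t $ i else 0)"
    by (rule sum.cong) (auto simp: axis_def)
  then show ?thesis by (simp add: char_torus_def)
qed

lemma continuous_on_char_torus [continuous_intros]: "continuous_on S (char_torus k)"
  unfolding char_torus_def by (intro continuous_intros)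

lemma cis_int_mult_2pi [simp]: "cis (real_of_int n * (2 * pi)) = 1"
  using cis_multiple_2pi[of "real_of_int n"] by (simp add: mult_ac)

lemma torus_periodic_char [simp]: "torus_periodic (char_torus k)"
  unfolding torus_periodic_def
  by (simp add: char_torus_add_right char_torus_axis_right)

lemma torus_periodic_mult:
  "torus_periodic f \<Longrightarrow> torus_periodic g \<Longrightarrow> torus_periodic (\<lambda>t. f t * g t)"
  by (simp add: torus_periodic_def)

lemma torus_periodic_compose:
  "torus_periodic f \<Longrightarrow> torus_periodic (\<lambda>t. F (f t))"
  by (simp add: torus_periodic_def)

lemma torus_periodic_diff:
  fixes f :: "real^'m \<Rightarrow> 'b::minus"
  shows "torus_periodic f \<Longrightarrow> torus_periodic g \<Longrightarrow> torus_periodic (\<lambda>t. f t - g t)"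
  by (simp add: torus_periodic_def)

lemma torus_periodic_translate:
  assumes "torus_periodic f"
  shows "torus_periodic (\<lambda>t. f (t + u))"
  using assms unfolding torus_periodic_def by (metis add.assoc add.commute)

lemma torus_integrable:
  fixes f :: "real^'m \<Rightarrow> 'b::euclidean_space"
  assumes "continuous_on UNIV f"
  shows "f integrable_on cbox a b"
  using assms by (meson continuous_on_subset integrable_continuous subset_UNIV)

lemma content_torus: "measure lborel (cbox 0 (\<chi> i. 2 * pi) :: (real^'m) set) = (2 * pi) ^ CARD('m)"
  by (subst content_cbox_cart) (auto simp: interval_ne_empty_cart)

lemma torus_mean_const [simp]:
  "torus_mean (\<lambda>t::real^'m. c :: 'b::euclidean_space) = c"
proof -
  have "(2 * pi) powr - real CARD('m) * (2 * pi) ^ CARD('m) = 1"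
    by (subst powr_minus, subst powr_realpow, simp, rule left_inverse) simp
  then show ?thesis
    unfolding torus_mean_def integral_const content_torus by (simp only: scaleR_scaleR scaleR_one)
qed

lemma torus_mean_add:
  fixes f g :: "real^'m \<Rightarrow> 'b::euclidean_space"
  assumes "continuous_on UNIV f" "continuous_on UNIV g"
  shows "torus_mean (\<lambda>t. f t + g t) = torus_mean f + torus_mean g"
  unfolding torus_mean_def
  by (simp add: integral_add torus_integrable assms scaleR_add_right)

lemma torus_mean_diff:
  fixes f g :: "real^'m \<Rightarrow> 'b::euclidean_space"
  assumes "continuous_on UNIV f" "continuous_on UNIV g"
  shows "torus_mean (\<lambda>t. f t - g t) = torus_mean f - torus_mean g"
  unfolding torus_mean_def
  by (simp add: integral_diff torus_integrable assms scaleR_diff_right)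

lemma torus_mean_sum:
  fixes f :: "'a \<Rightarrow> real^'m \<Rightarrow> 'b::euclidean_space"
  assumes "finite A" "\<And>a. a \<in> A \<Longrightarrow> continuous_on UNIV (f a)"
  shows "torus_mean (\<lambda>t. \<Sum>a\<in>A. f a t) = (\<Sum>a\<in>A. torus_mean (f a))"
  unfolding torus_mean_def
  by (simp add: integral_sum torus_integrable assms scaleR_sum_right)

lemma torus_mean_mult_left:
  fixes f :: "real^'m \<Rightarrow> 'b::{euclidean_space, real_normed_algebra}"
  assumes "continuous_on UNIV f"
  shows "torus_mean (\<lambda>t. c * f t) = c * torus_mean f"
proof -
  have "integral (cbox 0 (\<chi> i. 2 * pi)) (\<lambda>t. c * f t) = c * integral (cbox 0 (\<chi> i. 2 * pi)) f"
    using integral_linear[OF torus_integrable[OF assms], of "\<lambda>x. c * x"]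
    by (simp add: o_def bounded_linear_mult_right)
  then show ?thesis by (simp add: torus_mean_def)
qed

lemma torus_mean_bounded_linear:
  fixes f :: "real^'m \<Rightarrow> 'b::euclidean_space" and h :: "'b \<Rightarrow> 'c::euclidean_space"
  assumes "continuous_on UNIV f" "bounded_linear h"
  shows "torus_mean (\<lambda>t. h (f t)) = h (torus_mean f)"
  unfolding torus_mean_def
  using integral_linear[OF torus_integrable[OF assms(1)] assms(2)]
  by (simp add: o_def linear_simps[OF assms(2)])

lemma torus_mean_mono:
  fixes f g :: "real^'m \<Rightarrow> real"
  assumes "continuous_on UNIV f" "continuous_on UNIV g" "\<And>t. f t \<le> g t"
  shows "torus_mean f \<le> torus_mean g"
  unfolding torus_mean_def
  by (intro scaleR_left_mono integral_le torus_integrable assms) auto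

lemma norm_torus_mean_le:
  fixes f :: "real^'m \<Rightarrow> 'b::euclidean_space"
  assumes "continuous_on UNIV f" "continuous_on UNIV g" "\<And>t. norm (f t) \<le> g t"
  shows "norm (torus_mean f) \<le> torus_mean g"
proof -
  have "norm (integral (cbox 0 (\<chi> i. 2 * pi)) f) \<le> integral (cbox 0 (\<chi> i. 2 * pi)) g"
    by (intro integral_norm_bound_integral torus_integrable assms)
  then show ?thesis by (simp add: torus_mean_def)
qed

text \<open>Cut the box at height h and the translated box at height 2 * pi in coordinate i. The
  remaining slabs coincide, and the slab that sticks out is the one cut off, moved by a full
  period.\<close>

lemma torus_mean_shift:
  fixes f :: "real^'m \<Rightarrow> 'b::euclidean_space"
  assumes cont: "continuous_on UNIV f" and per: "torus_periodic f" and h: "0 \<le> h" "h \<le> 2 * pi"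
  shows "torus_mean (\<lambda>t. f (t + h *\<^sub>R axis i 1)) = torus_mean f"
proof -
  let ?e = "axis i 1 :: real^'m"
  let ?b = "(\<chi> j. 2 * pi) :: real^'m"
  have int: "f integrable_on cbox a b" for a b by (rule torus_integrable[OF cont])
  have trans: "integral (cbox a b) (\<lambda>t. f (t + c)) = integral (cbox (a + c) (b + c)) f" for a b c
    using integral_shift_cbox_plus[of a b f c] by (simp add: o_def add.commute)
  have e: "?e \<in> Basis" by simp
  have dot: "x \<bullet> ?e = x $ i" for x by (simp add: inner_axis)
  have box: "x \<in> cbox (\<chi> j. if j = i then a else 0) (\<chi> j. if j = i then b else 2 * pi)
      \<longleftrightarrow> a \<le> x $ i \<and> x $ i \<le> b \<and> (\<forall>j. j \<noteq> i \<longrightarrow> 0 \<le> x $ j \<and> x $ j \<le> 2 * pi)" for x :: "real^'m" and a b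
    by (auto simp: mem_box_cart split: if_splits)
  have vec: "(\<chi> j. if j = i then a else c) + (d *\<^sub>R ?e) = (\<chi> j. if j = i then a + d else c)" for a c d
    by (auto simp: vec_eq_iff axis_def)
  have Q: "cbox 0 ?b = cbox (\<chi> j. if j = i then 0 else 0) (\<chi> j. if j = i then 2 * pi else 2 * pi)"
    by (simp only: if_cancel zero_vec_def)
  have Qh: "cbox (h *\<^sub>R ?e) (?b + h *\<^sub>R ?e)
      = cbox (\<chi> j. if j = i then h else 0) (\<chi> j. if j = i then 2 * pi + h else 2 * pi)"
    by (intro arg_cong2[where f = cbox]) (auto simp: vec_eq_iff axis_def)
  have "integral (cbox 0 ?b) f
      = integral (cbox 0 ?b \<inter> {x. x \<bullet> ?e \<le> h}) f + integral (cbox 0 ?b \<inter> {x. h \<le> x \<bullet> ?e}) f"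
    by (rule integral_split[OF int e])
  moreover have "integral (cbox (h *\<^sub>R ?e) (?b + h *\<^sub>R ?e)) f
      = integral (cbox (h *\<^sub>R ?e) (?b + h *\<^sub>R ?e) \<inter> {x. x \<bullet> ?e \<le> 2 * pi}) f
        + integral (cbox (h *\<^sub>R ?e) (?b + h *\<^sub>R ?e) \<inter> {x. 2 * pi \<le> x \<bullet> ?e}) f"
    by (rule integral_split[OF int e])
  moreover have "cbox (h *\<^sub>R ?e) (?b + h *\<^sub>R ?e) \<inter> {x. x \<bullet> ?e \<le> 2 * pi} = cbox 0 ?b \<inter> {x. h \<le> x \<bullet> ?e}"
    unfolding dot Q Qh using h by (intro set_eqI) (auto simp: box simp del: if_cancel)
  moreover have "cbox 0 ?b \<inter> {x. x \<bullet> ?e \<le> h}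
      = cbox (\<chi> j. if j = i then 0 else 0) (\<chi> j. if j = i then h else 2 * pi)"
    unfolding dot Q using h by (intro set_eqI) (auto simp: box simp del: if_cancel)
  moreover have "cbox (h *\<^sub>R ?e) (?b + h *\<^sub>R ?e) \<inter> {x. 2 * pi \<le> x \<bullet> ?e}
      = cbox ((\<chi> j. if j = i then 0 else 0) + (2 * pi) *\<^sub>R ?e) ((\<chi> j. if j = i then h else 2 * pi) + (2 * pi) *\<^sub>R ?e)"
    unfolding dot Qh vec using h by (intro set_eqI) (auto simp: box simp del: if_cancel)
  moreover have "integral (cbox ((\<chi> j. if j = i then 0 else 0) + (2 * pi) *\<^sub>R ?e) ((\<chi> j. if j = i then h else 2 * pi) + (2 * pi) *\<^sub>R ?e)) f
      = integral (cbox (\<chi> j. if j = i then 0 else 0) (\<chi> j. if j = i then h else 2 * pi)) f"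
    unfolding trans[symmetric] using per by (simp add: torus_periodic_def)
  ultimately have "integral (cbox (h *\<^sub>R ?e) (?b + h *\<^sub>R ?e)) f = integral (cbox 0 ?b) f"
    by (simp only: add.commute)
  then show ?thesis
    by (simp add: torus_mean_def trans)
qed

text \<open>Translating by half a wavelength in a coordinate with nonzero \<open>k $ i\<close> flips
  the sign of the character, so its mean equals its own negative.\<close>

lemma torus_mean_char: "torus_mean (char_torus k) = (if k = 0 then 1 else 0)"
proof (cases "k = 0")
  case True
  then have "char_torus k = (\<lambda>t. 1)" by auto
  then show ?thesis using True by simp
next
  case False
  then obtain i where i: "k $ i \<noteq> 0" by (auto simp: vec_eq_iff)
  define h where "h = pi / \<bar>real_of_int (k $ i)\<bar>"
  have h: "0 \<le> h" "h \<le> 2 * pi" "\<bar>real_of_int (k $ i)\<bar> * h = pi"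
  proof -
    have "1 \<le> \<bar>real_of_int (k $ i)\<bar>" using i by linarith
    then have "h \<le> pi / 1" unfolding h_def by (intro divide_left_mono) auto
    then show "h \<le> 2 * pi" using pi_gt_zero by linarith
  qed (use i in \<open>auto simp: h_def\<close>)
  have "real_of_int (k $ i) * h = pi \<or> real_of_int (k $ i) * h = - pi"
    using h(3) by (auto simp: abs_if split: if_splits)
  then have m1: "char_torus k (h *\<^sub>R axis i 1) = -1"
    by (auto simp: char_torus_axis_right cis.ctr complex_eq_iff)
  have "torus_mean (char_torus k) = torus_mean (\<lambda>t. char_torus k (t + h *\<^sub>R axis i 1))"
    using torus_mean_shift[of "char_torus k" h i] h by (simp add: continuous_on_char_torus)
  also have "\<dots> = torus_mean (\<lambda>t. (-1) * char_torus k t)"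
    by (simp only: char_torus_add_right m1 mult.commute)
  also have "\<dots> = - torus_mean (char_torus k)"
    by (subst torus_mean_mult_left) (simp_all add: continuous_on_char_torus)
  finally show ?thesis using False by simp
qed

section \<open>Parseval's identity and Bessel's inequality\<close>

lemma parseval_trig_poly:
  assumes "finite J"
  shows "torus_mean (\<lambda>t. (norm (\<Sum>j\<in>J. d j * char_torus j t))\<^sup>2) = (\<Sum>j\<in>J. (norm (d j))\<^sup>2)"
proof -
  let ?P = "\<lambda>t. \<Sum>j\<in>J. d j * char_torus j t"
  have "complex_of_real (torus_mean (\<lambda>t. (norm (?P t))\<^sup>2))
      = torus_mean (\<lambda>t. complex_of_real ((norm (?P t))\<^sup>2))"
    by (subst torus_mean_bounded_linear[of _ complex_of_real])
      (auto intro!: continuous_intros bounded_linear_of_real)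
  also have "\<dots> = torus_mean (\<lambda>t. \<Sum>j\<in>J. \<Sum>l\<in>J. (d j * cnj (d l)) * char_torus (j - l) t)"
  proof -
    have "complex_of_real ((norm (?P t))\<^sup>2) = (\<Sum>j\<in>J. \<Sum>l\<in>J. (d j * cnj (d l)) * char_torus (j - l) t)" for t
      unfolding complex_norm_square cnj_sum sum_product
      by (intro sum.cong refl)
        (simp add: cnj_char_torus char_torus_add_left diff_conv_add_uminus del: add_uminus_conv_diff)
    then show ?thesis by (intro arg_cong[where f = torus_mean] ext)
  qed
  also have "\<dots> = (\<Sum>j\<in>J. \<Sum>l\<in>J. (d j * cnj (d l)) * (if j = l then 1 else 0))"
  proof -
    have "torus_mean (\<lambda>t. \<Sum>j\<in>J. \<Sum>l\<in>J. (d j * cnj (d l)) * char_torus (j - l) t)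
       = (\<Sum>j\<in>J. \<Sum>l\<in>J. torus_mean (\<lambda>t. (d j * cnj (d l)) * char_torus (j - l) t))"
      by (subst torus_mean_sum, (auto intro!: continuous_intros simp: assms)[2],
         intro sum.cong refl torus_mean_sum) (auto intro!: continuous_intros simp: assms)
    also have "\<dots> = (\<Sum>j\<in>J. \<Sum>l\<in>J. (d j * cnj (d l)) * (if j = l then 1 else 0))"
      by (intro sum.cong refl, subst torus_mean_mult_left)
        (auto intro!: continuous_intros simp: torus_mean_char)
    finally show ?thesis .
  qed
  also have "\<dots> = (\<Sum>j\<in>J. d j * cnj (d j))"
    by (intro sum.cong refl) (simp add: assms if_distrib[where f = "\<lambda>x. _ * x"] cong: if_cong)
  also have "\<dots> = complex_of_real (\<Sum>j\<in>J. (norm (d j))\<^sup>2)"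
    by (simp only: of_real_sum complex_norm_square)
  finally show ?thesis by (simp only: of_real_eq_iff)
qed

text \<open>Expand the mean of |f - S|^2, which is nonnegative, for the partial Fourier sum S over
  K; the cross term and the square of S contribute multiples of the same coefficient sum.\<close>

lemma bessel_torus:
  assumes cont: "continuous_on UNIV f" and "finite K"
  shows "(\<Sum>k\<in>K. (norm (fourier_coeff f k))\<^sup>2) \<le> torus_mean (\<lambda>t. (norm (f t))\<^sup>2)"
proof -
  define S where "S t = (\<Sum>k\<in>K. fourier_coeff f k * char_torus k t)" for t
  have cS: "continuous_on UNIV S" unfolding S_def by (intro continuous_intros)
  have "0 = torus_mean (\<lambda>t::real^'a. 0 :: real)" by simp
  also have "\<dots> \<le> torus_mean (\<lambda>t. (norm (f t - S t))\<^sup>2)"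
    by (intro torus_mean_mono) (auto intro!: continuous_intros cont cS)
  also have "\<dots> = torus_mean (\<lambda>t. ((norm (f t))\<^sup>2 + (norm (S t))\<^sup>2) - 2 * Re (f t * cnj (S t)))"
    by (intro arg_cong[where f = torus_mean] ext) (simp add: cmod_power2, simp add: power2_eq_square algebra_simps)
  also have "\<dots> = torus_mean (\<lambda>t. (norm (f t))\<^sup>2) + torus_mean (\<lambda>t. (norm (S t))\<^sup>2)
       - 2 * torus_mean (\<lambda>t. Re (f t * cnj (S t)))"
    by (subst torus_mean_diff, (intro continuous_intros cont cS)+, subst torus_mean_add,
        (intro continuous_intros cont cS)+, subst torus_mean_mult_left)
      (auto intro!: continuous_intros cont cS)
  also have "torus_mean (\<lambda>t. (norm (S t))\<^sup>2) = (\<Sum>k\<in>K. (norm (fourier_coeff f k))\<^sup>2)"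
    unfolding S_def by (rule parseval_trig_poly[OF assms(2)])
  also have "torus_mean (\<lambda>t. Re (f t * cnj (S t))) = Re (torus_mean (\<lambda>t. f t * cnj (S t)))"
    by (rule torus_mean_bounded_linear) (auto intro!: continuous_intros cont cS bounded_linear_Re)
  also have "torus_mean (\<lambda>t. f t * cnj (S t))
     = torus_mean (\<lambda>t. \<Sum>k\<in>K. cnj (fourier_coeff f k) * (f t * cnj (char_torus k t)))"
    unfolding S_def by (simp add: sum_distrib_left mult_ac)
  also have "\<dots> = (\<Sum>k\<in>K. cnj (fourier_coeff f k) * fourier_coeff f k)"
    by (subst torus_mean_sum[OF assms(2)], intro continuous_intros cont,
        intro sum.cong refl, subst torus_mean_mult_left)
      (auto intro!: continuous_intros cont simp: fourier_coeff_eq_mean)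
  also have "Re \<dots> = (\<Sum>k\<in>K. (norm (fourier_coeff f k))\<^sup>2)"
    by (simp add: cmod_power2) (simp add: power2_eq_square)
  finally show ?thesis by simp
qed

lemma fourier_coeff_translate:
  assumes cont: "continuous_on UNIV f" and per: "torus_periodic f" and h: "0 \<le> h" "h \<le> 2 * pi"
  shows "fourier_coeff (\<lambda>t. f (t + h *\<^sub>R axis i 1)) k = char_torus k (h *\<^sub>R axis i 1) * fourier_coeff f k"
proof -
  let ?u = "h *\<^sub>R axis i 1"
  let ?g = "\<lambda>t. f t * cnj (char_torus k t)"
  have g: "continuous_on UNIV ?g" by (intro continuous_intros cont)
  have one: "char_torus k u * cnj (char_torus k u) = 1" for u
    by (metis complex_norm_square norm_char_torus of_real_1 one_power2)
  have pg: "torus_periodic ?g"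
    by (intro torus_periodic_mult per torus_periodic_compose[of _ cnj] torus_periodic_char)
  have "fourier_coeff (\<lambda>t. f (t + ?u)) k = torus_mean (\<lambda>t. char_torus k ?u * ?g (t + ?u))"
    unfolding fourier_coeff_eq_mean char_torus_add_right complex_cnj_mult
    by (intro arg_cong[where f = torus_mean] ext) (use one[of ?u] in \<open>simp add: mult_ac\<close>)
  also have "\<dots> = char_torus k ?u * torus_mean (\<lambda>t. ?g (t + ?u))"
    by (rule torus_mean_mult_left) (intro continuous_intros continuous_on_compose2[OF cont] continuous_on_compose2[OF continuous_on_char_torus[of UNIV]]; simp)
  also have "torus_mean (\<lambda>t. ?g (t + ?u)) = torus_mean ?g"
    by (rule torus_mean_shift[OF g pg h])
  finally show ?thesis by (simp add: fourier_coeff_eq_mean)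
qed

section \<open>Upper bound\<close>

definition int_cube :: "real \<Rightarrow> (int^'m) set" where
  "int_cube R = {k. \<forall>i. \<bar>real_of_int (k $ i)\<bar> \<le> R}"

lemma int_cube_of_nat: "int_cube (real n) = {k. \<forall>i. k $ i \<in> {- int n..int n}}"
proof -
  have "\<bar>real_of_int x\<bar> \<le> real n \<longleftrightarrow> - int n \<le> x \<and> x \<le> int n" for x by linarith
  then show ?thesis unfolding int_cube_def by simp
qed

lemma card_int_cube_of_nat: "finite (int_cube (real n) :: (int^'m) set)"
  "card (int_cube (real n) :: (int^'m) set) = (2 * n + 1) ^ CARD('m)"
proof -
  let ?P = "PiE (UNIV :: 'm set) (\<lambda>_. {- int n..int n})"
  have eq: "(int_cube (real n) :: (int^'m) set) = vec_lambda ` ?P"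
  proof (intro equalityI subsetI)
    fix k :: "int^'m" assume "k \<in> int_cube (real n)"
    then have "vec_nth k \<in> ?P" by (auto simp: int_cube_of_nat PiE_UNIV_domain)
    then show "k \<in> vec_lambda ` ?P" by (metis image_eqI vec_nth_inverse)
  qed (auto simp: int_cube_of_nat PiE_UNIV_domain Pi_iff)
  show "finite (int_cube (real n) :: (int^'m) set)" unfolding eq by (intro finite_imageI finite_PiE) auto
  have "inj_on vec_lambda ?P" by (auto intro!: inj_onI simp: vec_lambda_inject)
  then have "card (int_cube (real n) :: (int^'m) set) = card ?P" unfolding eq by (rule card_image)
  also have "\<dots> = (2 * n + 1) ^ CARD('m)" by (simp add: card_PiE nat_add_distrib nat_mult_distrib)
  finally show "card (int_cube (real n) :: (int^'m) set) = (2 * n + 1) ^ CARD('m)" .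
qed

lemma card_int_cube_le:
  assumes "0 \<le> R"
  shows "finite (int_cube R :: (int^'m) set)"
    "real (card (int_cube R :: (int^'m) set)) \<le> (2 * R + 1) ^ CARD('m)"
proof -
  have sub: "(int_cube R :: (int^'m) set) \<subseteq> int_cube (real (nat \<lfloor>R\<rfloor>))"
    unfolding int_cube_def using assms by (auto simp: le_floor_iff abs_le_iff) (smt (verit) le_floor_iff of_int_minus)+
  show "finite (int_cube R :: (int^'m) set)"
    using sub card_int_cube_of_nat(1) finite_subset by blast
  have "real (card (int_cube R :: (int^'m) set)) \<le> real ((2 * nat \<lfloor>R\<rfloor> + 1) ^ CARD('m))"
    using card_mono[OF card_int_cube_of_nat(1) sub] unfolding card_int_cube_of_nat(2) by (rule of_nat_mono)
  also have "\<dots> = (2 * real (nat \<lfloor>R\<rfloor>) + 1) ^ CARD('m)" by (simp add: add.commute)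
  also have "\<dots> \<le> (2 * R + 1) ^ CARD('m)" using assms by (intro power_mono) auto
  finally show "real (card (int_cube R :: (int^'m) set)) \<le> (2 * R + 1) ^ CARD('m)" .
qed

text \<open>With an optimal threshold, this replaces Hoelder's inequality between \<open>l\<^sup>p\<close> and \<open>l\<^sup>2\<close>.\<close>

lemma powr_le_threshold_square:
  fixes x \<tau> p :: real
  assumes "0 \<le> x" "0 < \<tau>" "0 \<le> p" "p \<le> 2"
  shows "x powr p \<le> \<tau> powr p + \<tau> powr (p - 2) * x\<^sup>2"
proof (cases "x \<le> \<tau>")
  case True
  then have "x powr p \<le> \<tau> powr p" using assms by (intro powr_mono2) auto
  then show ?thesis by (simp add: add_increasing2)
next
  case False
  then have x: "0 < x" using assms by linarith
  have "x powr p = x powr (p - 2) * x\<^sup>2"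
    using x by (simp add: powr_diff powr_numeral)
  also have "\<dots> \<le> \<tau> powr (p - 2) * x\<^sup>2"
    using assms False by (intro mult_right_mono powr_mono2') auto
  finally show ?thesis by (simp add: add_increasing)
qed

lemma sum_powr_le_card_square:
  fixes a :: "'a \<Rightarrow> real"
  assumes "\<And>k. 0 \<le> a k" "0 < \<tau>" "0 \<le> p" "p \<le> 2"
  shows "(\<Sum>k\<in>K. a k powr p) \<le> card K * \<tau> powr p + \<tau> powr (p - 2) * (\<Sum>k\<in>K. (a k)\<^sup>2)"
proof -
  have "(\<Sum>k\<in>K. a k powr p) \<le> (\<Sum>k\<in>K. \<tau> powr p + \<tau> powr (p - 2) * (a k)\<^sup>2)"
    by (intro sum_mono powr_le_threshold_square assms)
  then show ?thesis by (simp add: sum.distrib sum_distrib_left)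
qed

text \<open>X plays the role of the dyadic factor 2^j of a single shell. The number of points
  contributes (X L)^\<beta> and the decay of the square sum contributes X^(-s p).\<close>

lemma sum_powr_le_of_square_decay:
  fixes a :: "int^'m \<Rightarrow> real"
  assumes a: "\<And>k. 0 \<le> a k" and p: "0 \<le> p" "p \<le> 2" and L: "1 \<le> L" and X: "1 \<le> X" and D: "0 \<le> D"
    and K: "K \<subseteq> int_cube (2 * X * L)"
    and sq: "(\<Sum>k\<in>K. (a k)\<^sup>2) \<le> D * X powr (- 2 * s)"
  defines "\<beta> \<equiv> real CARD('m) * (1 - p / 2)"
  shows "(\<Sum>k\<in>K. a k powr p) \<le> (5 ^ CARD('m) + D) * L powr \<beta> * X powr (\<beta> - s * p)"
proof -
  define m where "m = real CARD('m)"
  \<comment> \<open>Up to constants this is the root mean square of a over K when K has (X L)^m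
    points and square sum X^(-2s). With this choice both terms of
    \<open>sum_powr_le_card_square\<close> are of order (X L)^\<beta> X^(-s p).\<close>
  define \<tau> where "\<tau> = X powr (- s) * (X * L) powr (- m / 2)"
  have XL: "1 \<le> X * L" using L X by (metis mult_mono' mult_1 zero_le_one)
  have pos: "0 < X" "0 < L" "0 < X * L" using L X by auto
  have \<tau>: "0 < \<tau>" using pos by (simp add: \<tau>_def)
  have split: "(X * L) powr \<beta> * X powr (- s * p) = L powr \<beta> * X powr (\<beta> - s * p)"
    using pos by (simp add: powr_mult powr_diff powr_minus divide_simps)
  have "real (card K) \<le> real (card (int_cube (2 * X * L) :: (int^'m) set))"
    using K pos by (intro of_nat_mono card_mono card_int_cube_le) auto
  also have "\<dots> \<le> (2 * (2 * X * L) + 1) ^ CARD('m)"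
    using pos by (intro card_int_cube_le) auto
  also have "\<dots> \<le> (5 * (X * L)) ^ CARD('m)"
  proof (intro power_mono)
    show "2 * (2 * X * L) + 1 \<le> 5 * (X * L)" using XL by (simp only: mult.assoc)
  qed (use pos in simp)
  also have "\<dots> = 5 ^ CARD('m) * (X * L) powr m"
    using pos by (simp add: power_mult_distrib m_def powr_realpow)
  finally have card: "real (card K) \<le> 5 ^ CARD('m) * (X * L) powr m" .
  have \<tau>p: "\<tau> powr q = X powr (- s * q) * (X * L) powr (- m / 2 * q)" for q
    unfolding \<tau>_def using pos by (simp only: powr_mult powr_powr)
  have "real (card K) * \<tau> powr p \<le> 5 ^ CARD('m) * (X * L) powr m * \<tau> powr p"
    using card by (intro mult_right_mono) auto
  also have "\<dots> = 5 ^ CARD('m) * ((X * L) powr \<beta> * X powr (- s * p))"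
  proof -
    have "(X * L) powr \<beta> = (X * L) powr m * (X * L) powr (- m / 2 * p)"
      unfolding powr_add[symmetric] by (simp add: \<beta>_def m_def algebra_simps)
    then show ?thesis unfolding \<tau>p by (simp only: mult_ac)
  qed
  finally have 1: "real (card K) * \<tau> powr p \<le> 5 ^ CARD('m) * (L powr \<beta> * X powr (\<beta> - s * p))"
    unfolding split .
  have "\<tau> powr (p - 2) * (\<Sum>k\<in>K. (a k)\<^sup>2) \<le> \<tau> powr (p - 2) * (D * X powr (- 2 * s))"
    using sq by (intro mult_left_mono) auto
  also have "\<dots> = D * ((X * L) powr \<beta> * X powr (- s * p))"
  proof -
    have "X powr (- s * p) = X powr (- s * (p - 2)) * X powr (- 2 * s)"
      unfolding powr_add[symmetric] by (simp add: algebra_simps)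
    moreover have "- m / 2 * (p - 2) = \<beta>" by (simp add: \<beta>_def m_def field_simps)
    ultimately show ?thesis unfolding \<tau>p by (simp only: mult_ac)
  qed
  finally have 2: "\<tau> powr (p - 2) * (\<Sum>k\<in>K. (a k)\<^sup>2) \<le> D * (L powr \<beta> * X powr (\<beta> - s * p))"
    unfolding split .
  have "(\<Sum>k\<in>K. a k powr p) \<le> card K * \<tau> powr p + \<tau> powr (p - 2) * (\<Sum>k\<in>K. (a k)\<^sup>2)"
    by (intro sum_powr_le_card_square a \<tau> p)
  with 1 2 show ?thesis by (simp add: algebra_simps)
qed

text \<open>The innermost cube is treated as a shell with X = 1, with \<open>total\<close> in place
  of the decay; this is the summand 1 next to the geometric series of ratio 2 powr (\<beta> - s *
  p).\<close>

lemma sum_powr_le_of_dyadic_decay: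
  fixes a :: "int^'m \<Rightarrow> real"
  assumes a: "\<And>k. 0 \<le> a k" and p: "0 \<le> p" "p \<le> 2" and L: "1 \<le> L" and D: "0 \<le> D"
  defines "\<beta> \<equiv> real CARD('m) * (1 - p / 2)"
  assumes s: "\<beta> < s * p"
    and total: "\<And>K. finite K \<Longrightarrow> (\<Sum>k\<in>K. (a k)\<^sup>2) \<le> D"
    and shell: "\<And>j K. finite K \<Longrightarrow> K \<subseteq> int_cube (2 * 2 ^ j * L) - int_cube (2 ^ j * L)
        \<Longrightarrow> (\<Sum>k\<in>K. (a k)\<^sup>2) \<le> D * (2 ^ j) powr (- 2 * s)"
    and K: "finite K"
  shows "(\<Sum>k\<in>K. a k powr p) \<le> (5 ^ CARD('m) + D) * (1 + 1 / (1 - 2 powr (\<beta> - s * p))) * L powr \<beta>"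
proof -
  define q where "q = 2 powr (\<beta> - s * p)"
  define B where "B = (5 ^ CARD('m) + D) * L powr \<beta>"
  have q: "0 < q" "q < 1" using s by (auto simp: q_def powr_less_one)
  have B: "0 \<le> B" using D by (simp add: B_def)
  have ind: "(\<Sum>k\<in>K \<inter> int_cube (2 ^ J * L). a k powr p) \<le> B * (1 + (\<Sum>j<J. q ^ j))" for J
  proof (induction J)
    case 0
    have "(\<Sum>k\<in>K \<inter> int_cube (2 ^ 0 * L). a k powr p)
       \<le> (5 ^ CARD('m) + D) * L powr (real CARD('m) * (1 - p / 2)) * 1 powr (real CARD('m) * (1 - p / 2) - s * p)"
      using total[of "K \<inter> int_cube (2 ^ 0 * L)"] K L
      by (intro sum_powr_le_of_square_decay a p D) (auto simp: int_cube_def intro: order_trans)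
    then show ?case by (simp add: B_def \<beta>_def)
  next
    case (Suc J)
    let ?S = "K \<inter> (int_cube (2 * 2 ^ J * L) - int_cube (2 ^ J * L))"
    have "(\<Sum>k\<in>?S. a k powr p)
       \<le> (5 ^ CARD('m) + D) * L powr (real CARD('m) * (1 - p / 2)) * (2 ^ J) powr (real CARD('m) * (1 - p / 2) - s * p)"
      using shell[of ?S J] K L
      by (intro sum_powr_le_of_square_decay a p D) auto
    also have "\<dots> = B * q ^ J"
    proof -
      have "((2::real) ^ J) powr (\<beta> - s * p) = q ^ J"
        unfolding q_def by (simp add: powr_powr mult.commute flip: powr_realpow)
      then show ?thesis by (simp add: B_def \<beta>_def)
    qed
    finally have S: "(\<Sum>k\<in>?S. a k powr p) \<le> B * q ^ J" .
    have "(\<Sum>k\<in>K \<inter> int_cube (2 ^ Suc J * L). a k powr p)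
        \<le> (\<Sum>k\<in>(K \<inter> int_cube (2 ^ J * L)) \<union> ?S. a k powr p)"
      using K by (intro sum_mono2) auto
    also have "\<dots> = (\<Sum>k\<in>K \<inter> int_cube (2 ^ J * L). a k powr p) + (\<Sum>k\<in>?S. a k powr p)"
      using K by (intro sum.union_disjoint) auto
    also have "\<dots> \<le> B * (1 + (\<Sum>j<Suc J. q ^ j))"
      using Suc.IH S by (simp add: algebra_simps)
    finally show ?case .
  qed
  \<comment> \<open>A crude bound for all coordinates occurring in K, so that finitely many shells
    exhaust K.\<close>
  define M where "M = (\<Sum>k\<in>K. \<Sum>i\<in>UNIV. \<bar>real_of_int (k $ i)\<bar>)"
  obtain J where J: "M < 2 ^ J" using real_arch_pow[of 2 M] by auto
  have "K \<subseteq> int_cube (2 ^ J * L)"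
  proof
    fix k assume k: "k \<in> K"
    have "\<bar>real_of_int (k $ i)\<bar> \<le> 2 ^ J * L" for i
    proof -
      have "\<bar>real_of_int (k $ i)\<bar> \<le> (\<Sum>i\<in>UNIV. \<bar>real_of_int (k $ i)\<bar>)"
        by (rule member_le_sum) auto
      also have "\<dots> \<le> M" unfolding M_def by (rule member_le_sum[OF k]) (auto intro: sum_nonneg K)
      also have "\<dots> \<le> 2 ^ J * 1" using J by simp
      also have "\<dots> \<le> 2 ^ J * L" using L by (intro mult_left_mono) auto
      finally show ?thesis .
    qed
    then show "k \<in> int_cube (2 ^ J * L)" by (simp add: int_cube_def)
  qed
  then have "(\<Sum>k\<in>K. a k powr p) \<le> B * (1 + (\<Sum>j<J. q ^ j))"
    using ind[of J] by (simp add: Int_absorb2)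
  also have "\<dots> \<le> B * (1 + 1 / (1 - q))"
  proof -
    have "(\<Sum>j<J. q ^ j) = (1 - q ^ J) / (1 - q)" using q by (simp add: sum_gp_strict)
    also have "\<dots> \<le> 1 / (1 - q)" using q by (intro divide_right_mono) auto
    finally show ?thesis using B by (intro mult_left_mono) auto
  qed
  finally show ?thesis by (simp add: B_def q_def mult_ac)
qed

section \<open>Families smooth at scale 1 / \<bar>l\<bar>\<close>

text \<open>
  Families indexed by the large parameter \<open>l\<close> in which every differentiation in direction \<open>e\<close> costs
  a factor \<open>l\<close>. Rescaling the derivative by \<open>l\<close> makes the class stable under products, so that
  \<open>exp (\<i> l g)\<close> is handled by induction without a formula for its higher derivatives.
  The restriction \<open>0 < h\<close> avoids the junk value \<open>0 powr 0 = 0\<close>.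
\<close>

fun scaled_smooth :: "nat \<Rightarrow> real \<Rightarrow> real^('m::finite) \<Rightarrow> (real \<Rightarrow> real^'m \<Rightarrow> complex) \<Rightarrow> bool" where
  "scaled_smooth 0 \<alpha> e F \<longleftrightarrow>
     (\<exists>B. \<forall>l x. 1 \<le> \<bar>l\<bar> \<longrightarrow> norm (F l x) \<le> B) \<and>
     (\<exists>C. \<forall>l x h. 1 \<le> \<bar>l\<bar> \<longrightarrow> 0 < h \<longrightarrow> norm (F l (x + h *\<^sub>R e) - F l x) \<le> C * (\<bar>l\<bar> * h) powr \<alpha>)"
| "scaled_smooth (Suc n) \<alpha> e F \<longleftrightarrow>
     (\<exists>B. \<forall>l x. 1 \<le> \<bar>l\<bar> \<longrightarrow> norm (F l x) \<le> B) \<and>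
     (\<exists>F'. (\<forall>l x. 1 \<le> \<bar>l\<bar> \<longrightarrow> ((\<lambda>s. F l (x + s *\<^sub>R e)) has_vector_derivative l *\<^sub>R F' l x) (at 0))
        \<and> scaled_smooth n \<alpha> e F')"

lemma scaled_smooth_bounded:
  assumes "scaled_smooth n \<alpha> e F"
  obtains B where "0 \<le> B" "\<And>l x. 1 \<le> \<bar>l\<bar> \<Longrightarrow> norm (F l x) \<le> B"
proof -
  obtain B where "\<And>l x. 1 \<le> \<bar>l\<bar> \<Longrightarrow> norm (F l x) \<le> B"
    using assms by (cases n) auto
  then show ?thesis using that[of "max B 0"] by (meson max.cobounded1 max.cobounded2 order_trans)
qed

lemma scaled_smooth_0I:
  assumes "\<And>l x. 1 \<le> \<bar>l\<bar> \<Longrightarrow> norm (F l x) \<le> B"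
    and "\<And>l x h. 1 \<le> \<bar>l\<bar> \<Longrightarrow> 0 < h \<Longrightarrow> norm (F l (x + h *\<^sub>R e) - F l x) \<le> C * (\<bar>l\<bar> * h) powr \<alpha>"
  shows "scaled_smooth 0 \<alpha> e F"
  using assms unfolding scaled_smooth.simps by blast

lemma scaled_smooth_SucI:
  assumes "\<And>l x. 1 \<le> \<bar>l\<bar> \<Longrightarrow> norm (F l x) \<le> B"
    and "\<And>l x. 1 \<le> \<bar>l\<bar> \<Longrightarrow> ((\<lambda>s. F l (x + s *\<^sub>R e)) has_vector_derivative l *\<^sub>R F' l x) (at 0)"
    and "scaled_smooth n \<alpha> e F'"
  shows "scaled_smooth (Suc n) \<alpha> e F"
  unfolding scaled_smooth.simps by (intro conjI exI allI impI) (fact assms)+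

lemma scaled_smooth_0E:
  assumes "scaled_smooth 0 \<alpha> e F"
  obtains C where "\<And>l x h. 1 \<le> \<bar>l\<bar> \<Longrightarrow> 0 < h \<Longrightarrow> norm (F l (x + h *\<^sub>R e) - F l x) \<le> C * (\<bar>l\<bar> * h) powr \<alpha>"
  using assms unfolding scaled_smooth.simps by blast

lemma scaled_smooth_SucE:
  assumes "scaled_smooth (Suc n) \<alpha> e F"
  obtains F' where "\<And>l x. 1 \<le> \<bar>l\<bar> \<Longrightarrow> ((\<lambda>s. F l (x + s *\<^sub>R e)) has_vector_derivative l *\<^sub>R F' l x) (at 0)"
    "scaled_smooth n \<alpha> e F'"
  using assms unfolding scaled_smooth.simps by blast

text \<open>\<open>scaled_smooth\<close> differentiates at parameter 0 only, but at every base
  point; moving the base point along the line yields the derivative at every parameter.\<close>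

lemma line_derivative_shift:
  fixes u :: "real^'m \<Rightarrow> 'b::real_normed_vector"
  assumes "\<And>x. ((\<lambda>s. u (x + s *\<^sub>R e)) has_vector_derivative u' x) (at 0)"
  shows "((\<lambda>s. u (x + s *\<^sub>R e)) has_vector_derivative u' (x + s *\<^sub>R e)) (at s)"
proof -
  have "((\<lambda>r. u ((x + s *\<^sub>R e) + r *\<^sub>R e)) has_vector_derivative u' (x + s *\<^sub>R e)) (at (s - s))"
    using assms[of "x + s *\<^sub>R e"] by simp
  then have "(((\<lambda>r. u ((x + s *\<^sub>R e) + r *\<^sub>R e)) \<circ> (\<lambda>r. r - s)) has_vector_derivative
       1 *\<^sub>R u' (x + s *\<^sub>R e)) (at s)"
    by (intro vector_diff_chain_at) (auto intro!: derivative_eq_intros)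
  then show ?thesis by (simp add: o_def algebra_simps)
qed

lemma line_mean_value:
  fixes u :: "real^'m \<Rightarrow> 'b::real_normed_vector"
  assumes der: "\<And>x. ((\<lambda>s. u (x + s *\<^sub>R e)) has_vector_derivative u' x) (at 0)"
    and bound: "\<And>x. norm (u' x) \<le> B" and "0 \<le> h"
  shows "norm (u (x + h *\<^sub>R e) - u x) \<le> B * h"
proof -
  have "norm (u (x + h *\<^sub>R e) - u (x + 0 *\<^sub>R e)) \<le> B * norm (h - 0)"
  proof (rule differentiable_bound[OF convex_UNIV])
    show "((\<lambda>s. u (x + s *\<^sub>R e)) has_derivative (\<lambda>r. r *\<^sub>R u' (x + s *\<^sub>R e))) (at s within UNIV)" for s
      using line_derivative_shift[of u e u', OF der] by (simp add: has_vector_derivative_def)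
    show "onorm (\<lambda>r. r *\<^sub>R u' (x + s *\<^sub>R e)) \<le> B" for s
      using bound[of "x + s *\<^sub>R e"] by (intro onorm_le) (simp add: mult.commute[of B] mult_left_mono)
  qed auto
  then show ?thesis using \<open>0 \<le> h\<close> by simp
qed

text \<open>Interpolates between the trivial bound 2 B, used when \<bar>l\<bar> h > 1, and the mean
  value bound B' \<bar>l\<bar> h, used otherwise; each is dominated by the power \<alpha> of
  \<bar>l\<bar> h because 0 \<le> \<alpha> \<le> 1.\<close>

lemma scaled_smooth_0_of_derivative:
  assumes "0 \<le> \<alpha>" "\<alpha> \<le> 1"
    and B: "\<And>l x. 1 \<le> \<bar>l\<bar> \<Longrightarrow> norm (F l x) \<le> B"
    and B': "\<And>l x. 1 \<le> \<bar>l\<bar> \<Longrightarrow> norm (F' l x) \<le> B'"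
    and der: "\<And>l x. 1 \<le> \<bar>l\<bar> \<Longrightarrow> ((\<lambda>s. F l (x + s *\<^sub>R e)) has_vector_derivative l *\<^sub>R F' l x) (at 0)"
  shows "scaled_smooth 0 \<alpha> e F"
proof -
  have "norm (F l (x + h *\<^sub>R e) - F l x) \<le> max (2 * B) B' * (\<bar>l\<bar> * h) powr \<alpha>"
    if l: "1 \<le> \<bar>l\<bar>" and h: "0 < h" for l x h
  proof -
    have pos: "0 < \<bar>l\<bar> * h" using l h by simp
    have "0 \<le> B" "0 \<le> B'" using B[OF l, of x] B'[OF l, of x] norm_ge_zero order_trans by blast+
    have 1: "norm (F l (x + h *\<^sub>R e) - F l x) \<le> 2 * B"
      using norm_triangle_ineq4[of "F l (x + h *\<^sub>R e)" "F l x"] B[OF l] by (smt (verit))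
    have 2: "norm (F l (x + h *\<^sub>R e) - F l x) \<le> (\<bar>l\<bar> * B') * h"
      using l h B' by (intro line_mean_value[where u' = "\<lambda>x. l *\<^sub>R F' l x"] der)
        (auto intro: mult_left_mono)
    show ?thesis
    proof (cases "\<bar>l\<bar> * h \<le> 1")
      case True
      have "\<bar>l\<bar> * h = (\<bar>l\<bar> * h) powr 1" using pos by simp
      also have "\<dots> \<le> (\<bar>l\<bar> * h) powr \<alpha>" using pos True assms by (intro powr_mono') auto
      finally have "B' * (\<bar>l\<bar> * h) \<le> max (2 * B) B' * (\<bar>l\<bar> * h) powr \<alpha>"
        using \<open>0 \<le> B'\<close> pos by (intro mult_mono) auto
      then show ?thesis using 2 by (simp add: mult_ac)
    next
      case False
      then have "1 \<le> (\<bar>l\<bar> * h) powr \<alpha>" using assms by (intro ge_one_powr_ge_zero) auto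
      then have "(2 * B) * 1 \<le> max (2 * B) B' * (\<bar>l\<bar> * h) powr \<alpha>"
        using \<open>0 \<le> B\<close> by (intro mult_mono) auto
      then show ?thesis using 1 by simp
    qed
  qed
  then show ?thesis using B unfolding scaled_smooth.simps by blast
qed

text \<open>The product rule multiplies a derivative, known to order n, by a factor known to order
  Suc n; lowering the order of that factor keeps the induction for products going.\<close>

lemma scaled_smooth_SucD:
  assumes "0 \<le> \<alpha>" "\<alpha> \<le> 1" "scaled_smooth (Suc n) \<alpha> e F"
  shows "scaled_smooth n \<alpha> e F"
  using assms(3)
proof (induction n arbitrary: F)
  case 0
  then obtain F' where F': "\<And>l x. 1 \<le> \<bar>l\<bar> \<Longrightarrow> ((\<lambda>s. F l (x + s *\<^sub>R e)) has_vector_derivative l *\<^sub>R F' l x) (at 0)"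
     "scaled_smooth 0 \<alpha> e F'" using scaled_smooth_SucE[OF 0] by metis
  from scaled_smooth_bounded[OF 0] obtain B where B: "\<And>l x. 1 \<le> \<bar>l\<bar> \<Longrightarrow> norm (F l x) \<le> B" by metis
  from scaled_smooth_bounded[OF F'(2)] obtain B' where B': "\<And>l x. 1 \<le> \<bar>l\<bar> \<Longrightarrow> norm (F' l x) \<le> B'" by metis
  show ?case by (rule scaled_smooth_0_of_derivative[OF assms(1,2) B B' F'(1)])
next
  case (Suc n)
  obtain F' where F': "\<And>l x. 1 \<le> \<bar>l\<bar> \<Longrightarrow> ((\<lambda>s. F l (x + s *\<^sub>R e)) has_vector_derivative l *\<^sub>R F' l x) (at 0)"
     "scaled_smooth (Suc n) \<alpha> e F'" using scaled_smooth_SucE[OF Suc.prems] by metis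
  obtain B where "\<And>l x. 1 \<le> \<bar>l\<bar> \<Longrightarrow> norm (F l x) \<le> B" using scaled_smooth_bounded[OF Suc.prems] by metis
  then show ?case by (intro scaled_smooth_SucI[where F' = F'] F'(1) Suc.IH[OF F'(2)])
qed

lemma scaled_smooth_mono:
  assumes "0 \<le> \<alpha>" "\<alpha> \<le> 1" "scaled_smooth n \<alpha> e F" "k \<le> n"
  shows "scaled_smooth k \<alpha> e F"
  using assms(4)
proof (induction rule: inc_induct)
  case (step k)
  show ?case by (rule scaled_smooth_SucD[OF assms(1,2) step.IH])
qed (rule assms(3))

lemma scaled_smooth_add:
  "scaled_smooth n \<alpha> e F \<Longrightarrow> scaled_smooth n \<alpha> e G \<Longrightarrow> scaled_smooth n \<alpha> e (\<lambda>l x. F l x + G l x)"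
proof (induction n arbitrary: F G)
  case 0
  obtain B where B: "\<And>l x. 1 \<le> \<bar>l\<bar> \<Longrightarrow> norm (F l x) \<le> B" using scaled_smooth_bounded[OF 0(1)] by metis
  obtain B' where B': "\<And>l x. 1 \<le> \<bar>l\<bar> \<Longrightarrow> norm (G l x) \<le> B'" using scaled_smooth_bounded[OF 0(2)] by metis
  obtain C where C: "\<And>l x h. 1 \<le> \<bar>l\<bar> \<Longrightarrow> 0 < h \<Longrightarrow> norm (F l (x + h *\<^sub>R e) - F l x) \<le> C * (\<bar>l\<bar> * h) powr \<alpha>"
    using scaled_smooth_0E[OF 0(1)] by metis
  obtain C' where C': "\<And>l x h. 1 \<le> \<bar>l\<bar> \<Longrightarrow> 0 < h \<Longrightarrow> norm (G l (x + h *\<^sub>R e) - G l x) \<le> C' * (\<bar>l\<bar> * h) powr \<alpha>"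
    using scaled_smooth_0E[OF 0(2)] by metis
  have "norm (F l x + G l x) \<le> B + B'" if "1 \<le> \<bar>l\<bar>" for l x
    using B[OF that] B'[OF that] by (meson add_mono norm_triangle_ineq order_trans)
  moreover have "norm (F l (x + h *\<^sub>R e) + G l (x + h *\<^sub>R e) - (F l x + G l x)) \<le> (C + C') * (\<bar>l\<bar> * h) powr \<alpha>"
    if "1 \<le> \<bar>l\<bar>" "0 < h" for l x h
    using norm_triangle_ineq[of "F l (x + h *\<^sub>R e) - F l x" "G l (x + h *\<^sub>R e) - G l x"]
      C[OF that, of x] C'[OF that, of x] by (simp add: algebra_simps)
  ultimately show ?case by (rule scaled_smooth_0I)
next
  case (Suc n)
  obtain B where B: "\<And>l x. 1 \<le> \<bar>l\<bar> \<Longrightarrow> norm (F l x) \<le> B" using scaled_smooth_bounded[OF Suc.prems(1)] by metis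
  obtain B' where B': "\<And>l x. 1 \<le> \<bar>l\<bar> \<Longrightarrow> norm (G l x) \<le> B'" using scaled_smooth_bounded[OF Suc.prems(2)] by metis
  have bd: "norm (F l x + G l x) \<le> B + B'" if "1 \<le> \<bar>l\<bar>" for l x
    using B[OF that] B'[OF that] by (meson add_mono norm_triangle_ineq order_trans)
  obtain F' where F': "\<And>l x. 1 \<le> \<bar>l\<bar> \<Longrightarrow> ((\<lambda>s. F l (x + s *\<^sub>R e)) has_vector_derivative l *\<^sub>R F' l x) (at 0)"
     "scaled_smooth n \<alpha> e F'" using scaled_smooth_SucE[OF Suc.prems(1)] by metis
  obtain G' where G': "\<And>l x. 1 \<le> \<bar>l\<bar> \<Longrightarrow> ((\<lambda>s. G l (x + s *\<^sub>R e)) has_vector_derivative l *\<^sub>R G' l x) (at 0)"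
     "scaled_smooth n \<alpha> e G'" using scaled_smooth_SucE[OF Suc.prems(2)] by metis
  have der: "((\<lambda>s. F l (x + s *\<^sub>R e) + G l (x + s *\<^sub>R e)) has_vector_derivative l *\<^sub>R (F' l x + G' l x)) (at 0)"
    if "1 \<le> \<bar>l\<bar>" for l x
    using has_vector_derivative_add[OF F'(1)[OF that] G'(1)[OF that]] by (simp add: scaleR_add_right)
  have "scaled_smooth n \<alpha> e (\<lambda>l x. F' l x + G' l x)"
    by (rule Suc.IH[OF F'(2) G'(2)])
  then show ?case by (intro scaled_smooth_SucI[where B = "B + B'" and F' = "\<lambda>l x. F' l x + G' l x"] bd der)
qed

lemma scaled_smooth_mult:
  assumes \<alpha>: "0 \<le> \<alpha>" "\<alpha> \<le> 1"
  shows "scaled_smooth n \<alpha> e F \<Longrightarrow> scaled_smooth n \<alpha> e G \<Longrightarrow> scaled_smooth n \<alpha> e (\<lambda>l x. F l x * G l x)"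
proof (induction n arbitrary: F G)
  case 0
  obtain B where B: "0 \<le> B" "\<And>l x. 1 \<le> \<bar>l\<bar> \<Longrightarrow> norm (F l x) \<le> B" using scaled_smooth_bounded[OF 0(1)] by metis
  obtain B' where B': "0 \<le> B'" "\<And>l x. 1 \<le> \<bar>l\<bar> \<Longrightarrow> norm (G l x) \<le> B'" using scaled_smooth_bounded[OF 0(2)] by metis
  obtain C where C: "\<And>l x h. 1 \<le> \<bar>l\<bar> \<Longrightarrow> 0 < h \<Longrightarrow> norm (F l (x + h *\<^sub>R e) - F l x) \<le> C * (\<bar>l\<bar> * h) powr \<alpha>"
    using scaled_smooth_0E[OF 0(1)] by metis
  obtain C' where C': "\<And>l x h. 1 \<le> \<bar>l\<bar> \<Longrightarrow> 0 < h \<Longrightarrow> norm (G l (x + h *\<^sub>R e) - G l x) \<le> C' * (\<bar>l\<bar> * h) powr \<alpha>"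
    using scaled_smooth_0E[OF 0(2)] by metis
  have "norm (F l x * G l x) \<le> B * B'" if "1 \<le> \<bar>l\<bar>" for l x
    unfolding norm_mult using B B' that by (intro mult_mono) auto
  moreover have "norm (F l (x + h *\<^sub>R e) * G l (x + h *\<^sub>R e) - F l x * G l x) \<le> (C * B' + B * C') * (\<bar>l\<bar> * h) powr \<alpha>"
    if l: "1 \<le> \<bar>l\<bar>" "0 < h" for l x h
  proof -
    let ?y = "x + h *\<^sub>R e"
    have "norm (F l ?y * G l ?y - F l x * G l x)
        = norm ((F l ?y - F l x) * G l ?y + F l x * (G l ?y - G l x))"
      by (simp add: algebra_simps)
    also have "\<dots> \<le> norm (F l ?y - F l x) * norm (G l ?y) + norm (F l x) * norm (G l ?y - G l x)"
      by (metis norm_mult norm_triangle_ineq)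
    also have "\<dots> \<le> C * (\<bar>l\<bar> * h) powr \<alpha> * B' + B * (C' * (\<bar>l\<bar> * h) powr \<alpha>)"
      using B(1) B(2)[OF l(1)] B'(2)[OF l(1)] C[OF l, of x] C'[OF l, of x]
        order_trans[OF norm_ge_zero C[OF l, of x]] order_trans[OF norm_ge_zero C'[OF l, of x]]
      by (intro add_mono mult_mono) auto
    finally show ?thesis by (simp add: algebra_simps)
  qed
  ultimately show ?case by (rule scaled_smooth_0I)
next
  case (Suc n)
  obtain B where B: "0 \<le> B" "\<And>l x. 1 \<le> \<bar>l\<bar> \<Longrightarrow> norm (F l x) \<le> B" using scaled_smooth_bounded[OF Suc.prems(1)] by metis
  obtain B' where B': "0 \<le> B'" "\<And>l x. 1 \<le> \<bar>l\<bar> \<Longrightarrow> norm (G l x) \<le> B'" using scaled_smooth_bounded[OF Suc.prems(2)] by metis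
  have bd: "norm (F l x * G l x) \<le> B * B'" if "1 \<le> \<bar>l\<bar>" for l x
    unfolding norm_mult using B B' that by (intro mult_mono) auto
  obtain F' where F': "\<And>l x. 1 \<le> \<bar>l\<bar> \<Longrightarrow> ((\<lambda>s. F l (x + s *\<^sub>R e)) has_vector_derivative l *\<^sub>R F' l x) (at 0)"
     "scaled_smooth n \<alpha> e F'" using scaled_smooth_SucE[OF Suc.prems(1)] by metis
  obtain G' where G': "\<And>l x. 1 \<le> \<bar>l\<bar> \<Longrightarrow> ((\<lambda>s. G l (x + s *\<^sub>R e)) has_vector_derivative l *\<^sub>R G' l x) (at 0)"
     "scaled_smooth n \<alpha> e G'" using scaled_smooth_SucE[OF Suc.prems(2)] by metis
  have der: "((\<lambda>s. F l (x + s *\<^sub>R e) * G l (x + s *\<^sub>R e)) has_vector_derivative l *\<^sub>R (F' l x * G l x + F l x * G' l x)) (at 0)"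
    if "1 \<le> \<bar>l\<bar>" for l x
    using has_vector_derivative_mult[OF F'(1)[OF that] G'(1)[OF that]]
    by (simp add: scaleR_add_right add.commute)
  have "scaled_smooth n \<alpha> e (\<lambda>l x. F' l x * G l x + F l x * G' l x)"
    by (intro scaled_smooth_add Suc.IH F'(2) G'(2) scaled_smooth_SucD[OF \<alpha> Suc.prems(1)] scaled_smooth_SucD[OF \<alpha> Suc.prems(2)])
  then show ?case by (intro scaled_smooth_SucI[where B = "B * B'" and F' = "\<lambda>l x. F' l x * G l x + F l x * G' l x"] bd der)
qed

section \<open>Iterated differences and their Fourier coefficients\<close>

definition fwd_diff :: "'a::ab_group_add \<Rightarrow> ('a \<Rightarrow> 'b::ab_group_add) \<Rightarrow> 'a \<Rightarrow> 'b" where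
  "fwd_diff u f x = f (x + u) - f x"

lemma fwd_diff_funpow_Suc:
  "(fwd_diff u ^^ Suc n) f x = (fwd_diff u ^^ n) f (x + u) - (fwd_diff u ^^ n) f x"
  by (simp add: fwd_diff_def)

lemma fwd_diff_iter_derivative:
  fixes u :: "real^'m \<Rightarrow> 'b::real_normed_vector"
  assumes "\<And>x. ((\<lambda>s. u (x + s *\<^sub>R e)) has_vector_derivative c *\<^sub>R u' x) (at 0)"
  shows "((\<lambda>s. (fwd_diff v ^^ n) u (x + s *\<^sub>R e)) has_vector_derivative c *\<^sub>R (fwd_diff v ^^ n) u' x) (at 0)"
proof (induction n arbitrary: x)
  case (Suc n)
  have "((\<lambda>s. (fwd_diff v ^^ n) u ((x + v) + s *\<^sub>R e) - (fwd_diff v ^^ n) u (x + s *\<^sub>R e)) has_vector_derivative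
      c *\<^sub>R (fwd_diff v ^^ n) u' (x + v) - c *\<^sub>R (fwd_diff v ^^ n) u' x) (at 0)"
    by (intro has_vector_derivative_diff Suc)
  then show ?case unfolding fwd_diff_funpow_Suc scaleR_diff_right by (simp add: add_ac)
qed (use assms in simp)

text \<open>Differences commute with differentiation, so n of them can be traded for derivatives by
  the mean value bound, each with gain \<bar>l\<bar> h. The last difference is the Hoelder estimate
  at order 0.\<close>

lemma scaled_smooth_fwd_diff:
  assumes "scaled_smooth n \<alpha> e F"
  shows "\<exists>C. \<forall>l x h. 1 \<le> \<bar>l\<bar> \<longrightarrow> 0 < h \<longrightarrow>
    norm ((fwd_diff (h *\<^sub>R e) ^^ Suc n) (F l) x) \<le> C * (\<bar>l\<bar> * h) powr (real n + \<alpha>)"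
  using assms
proof (induction n arbitrary: F)
  case 0
  then show ?case by (auto simp: fwd_diff_def)
next
  case (Suc n)
  obtain F' where F': "\<And>l x. 1 \<le> \<bar>l\<bar> \<Longrightarrow> ((\<lambda>s. F l (x + s *\<^sub>R e)) has_vector_derivative l *\<^sub>R F' l x) (at 0)"
     "scaled_smooth n \<alpha> e F'" using scaled_smooth_SucE[OF Suc.prems] by metis
  from Suc.IH[OF F'(2)] obtain C where C: "\<And>l x h. 1 \<le> \<bar>l\<bar> \<Longrightarrow> 0 < h \<Longrightarrow>
    norm ((fwd_diff (h *\<^sub>R e) ^^ Suc n) (F' l) x) \<le> C * (\<bar>l\<bar> * h) powr (real n + \<alpha>)" by blast
  have "norm ((fwd_diff (h *\<^sub>R e) ^^ Suc (Suc n)) (F l) x) \<le> C * (\<bar>l\<bar> * h) powr (real (Suc n) + \<alpha>)"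
    if l: "1 \<le> \<bar>l\<bar>" "0 < h" for l x h
  proof -
    let ?D = "fwd_diff (h *\<^sub>R e) ^^ Suc n"
    have "norm (?D (F l) (x + h *\<^sub>R e) - ?D (F l) x) \<le> (\<bar>l\<bar> * (C * (\<bar>l\<bar> * h) powr (real n + \<alpha>))) * h"
    proof (rule line_mean_value[where u' = "\<lambda>x. l *\<^sub>R ?D (F' l) x"])
      show "((\<lambda>s. ?D (F l) (x + s *\<^sub>R e)) has_vector_derivative l *\<^sub>R ?D (F' l) x) (at 0)" for x
        by (rule fwd_diff_iter_derivative[OF F'(1)[OF l(1)]])
      show "norm (l *\<^sub>R ?D (F' l) x) \<le> \<bar>l\<bar> * (C * (\<bar>l\<bar> * h) powr (real n + \<alpha>))" for x
        unfolding norm_scaleR by (intro mult_left_mono C l) auto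
    qed (use l in simp)
    also have "\<dots> = C * ((\<bar>l\<bar> * h) powr 1 * (\<bar>l\<bar> * h) powr (real n + \<alpha>))"
      using l by simp
    also have "\<dots> = C * (\<bar>l\<bar> * h) powr (real (Suc n) + \<alpha>)"
      unfolding powr_add[symmetric] by (simp add: add_ac)
    finally show ?thesis by (subst fwd_diff_funpow_Suc)
  qed
  then show ?case by blast
qed

text \<open>The three claims share one induction because the translation formula asks for continuity
  and periodicity of the previous difference.\<close>

lemma fourier_coeff_fwd_diff_iter:
  fixes i :: "'m::finite" and f :: "real^'m \<Rightarrow> complex"
  assumes cont: "continuous_on UNIV f" and per: "torus_periodic f" and h: "0 \<le> h" "h \<le> 2 * pi"
  defines "D \<equiv> \<lambda>n. (fwd_diff (h *\<^sub>R axis i 1) ^^ n) f"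
  shows "continuous_on UNIV (D n)" "torus_periodic (D n)"
    "fourier_coeff (D n) k = (cis (real_of_int (k $ i) * h) - 1) ^ n * fourier_coeff f k"
proof (induction n)
  case 0
  {
    case 1 show ?case using cont by (simp add: D_def)
  next
    case 2 show ?case using per by (simp add: D_def)
  next
    case 3 show ?case by (simp add: D_def)
  }
next
  case (Suc n)
  let ?u = "h *\<^sub>R axis i 1"
  have D: "D (Suc n) = (\<lambda>x. D n (x + ?u) - D n x)" by (auto simp: D_def fwd_diff_def)
  have cont': "continuous_on UNIV (\<lambda>x. D n (x + ?u))"
    by (rule continuous_on_compose2[OF Suc(1)]) (auto intro!: continuous_intros)
  {
    case 1 show ?case unfolding D by (intro continuous_intros cont' Suc)
  next
    case 2 show ?case unfolding D by (intro torus_periodic_diff torus_periodic_translate Suc)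
  next
    case 3
    have "fourier_coeff (D (Suc n)) k = fourier_coeff (\<lambda>x. D n (x + ?u)) k - fourier_coeff (D n) k"
      unfolding D fourier_coeff_eq_mean left_diff_distrib
      by (rule torus_mean_diff) (intro continuous_intros cont' Suc)+
    then show ?case
      unfolding fourier_coeff_translate[OF Suc(1,2) h] Suc(3) char_torus_axis_right
      by (simp add: algebra_simps)
  }
qed

text \<open>The step h = 1 / (2^j \<bar>l\<bar>) is tuned to the shell: some coordinate of k has
  modulus between 1/h and 2/h, so the multiplier cis (k $ i * h) - 1 stays away from its zeros,
  while the differences are uniformly O(2^(-j (n + \<alpha>))).\<close>

lemma fourier_square_sum_scaled_smooth:
  assumes smooth: "\<And>i. scaled_smooth n \<alpha> (axis i 1 :: real^'m) F"
    and cont: "\<And>l. continuous_on UNIV (F l)" and per: "\<And>l. torus_periodic (F l)"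
  shows "\<exists>D\<ge>0. \<forall>l j K. 1 \<le> \<bar>l\<bar> \<longrightarrow> finite K \<longrightarrow> K \<subseteq> int_cube (2 * 2 ^ j * \<bar>l\<bar>) - int_cube (2 ^ j * \<bar>l\<bar>)
    \<longrightarrow> (\<Sum>k\<in>K. (norm (fourier_coeff (F l) k))\<^sup>2) \<le> D * (2 ^ j) powr (- 2 * (real n + \<alpha>))"
proof -
  \<comment> \<open>Lower bound for the power Suc n of |cis \<theta> - 1|^2 = 2 - 2 cos \<theta>
    when 1 \<le> |\<theta>| \<le> 2; here 2 < pi matters.\<close>
  define d where "d = (2 - 2 * cos (1::real)) ^ Suc n"
  have "cos (1::real) < cos 0" using pi_gt3 by (intro cos_monotone_0_pi) auto
  then have d: "0 < d" by (simp add: d_def)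
  have "\<forall>i. \<exists>C. \<forall>l x h. 1 \<le> \<bar>l\<bar> \<longrightarrow> 0 < h \<longrightarrow>
    norm ((fwd_diff (h *\<^sub>R axis i 1 :: real^'m) ^^ Suc n) (F l) x) \<le> C * (\<bar>l\<bar> * h) powr (real n + \<alpha>)"
    using scaled_smooth_fwd_diff[OF smooth] by blast
  then obtain C where C: "\<And>i l x h. 1 \<le> \<bar>l\<bar> \<Longrightarrow> 0 < h \<Longrightarrow>
    norm ((fwd_diff (h *\<^sub>R axis i 1 :: real^'m) ^^ Suc n) (F l) x) \<le> C i * (\<bar>l\<bar> * h) powr (real n + \<alpha>)"
    by metis
  have "(\<Sum>k\<in>K. (norm (fourier_coeff (F l) k))\<^sup>2) \<le> ((\<Sum>i\<in>UNIV. (C i)\<^sup>2) / d) * (2 ^ j) powr (- 2 * (real n + \<alpha>))"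
    if l: "1 \<le> \<bar>l\<bar>" and K: "finite K" "K \<subseteq> int_cube (2 * 2 ^ j * \<bar>l\<bar>) - int_cube (2 ^ j * \<bar>l\<bar>)" for l j K
  proof -
    define h where "h = 1 / (2 ^ j * \<bar>l\<bar>)"
    have "1 * 1 \<le> 2 ^ j * \<bar>l\<bar>" using l by (intro mult_mono) auto
    then have "h \<le> 1" by (simp add: h_def)
    then have "h \<le> 2 * pi" using pi_gt3 by linarith
    then have h: "0 < h" "0 \<le> h" "h \<le> 2 * pi" "\<bar>l\<bar> * h = 1 / 2 ^ j"
      using l by (auto simp: h_def)
    let ?D = "\<lambda>i. (fwd_diff (h *\<^sub>R axis i 1 :: real^'m) ^^ Suc n) (F l)"
    \<comment> \<open>The direction of differencing depends on k. The sets S i may overlap, so the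
      sum over K is only bounded by the sum over all i.\<close>
    define S where "S i = {k \<in> K. 1 \<le> \<bar>real_of_int (k $ i)\<bar> * h}" for i
    have S: "finite (S i)" for i using K by (simp add: S_def)
    have cover: "K \<subseteq> (\<Union>i. S i)"
    proof
      fix k assume k: "k \<in> K"
      then obtain i where "\<not> \<bar>real_of_int (k $ i)\<bar> \<le> 2 ^ j * \<bar>l\<bar>"
        using K(2) by (auto simp: int_cube_def)
      then have "1 \<le> \<bar>real_of_int (k $ i)\<bar> * h"
        using l by (simp add: h_def divide_simps mult.commute)
      with k show "k \<in> (\<Union>i. S i)" by (auto simp: S_def)
    qed
    have each: "d * (\<Sum>k\<in>S i. (norm (fourier_coeff (F l) k))\<^sup>2) \<le> (C i)\<^sup>2 * (2 ^ j) powr (- 2 * (real n + \<alpha>))" for i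
    proof -
      note fc = fourier_coeff_fwd_diff_iter[OF cont[of l] per[of l] h(2,3), where n = "Suc n" and i = i]
      have "d * (\<Sum>k\<in>S i. (norm (fourier_coeff (F l) k))\<^sup>2) \<le> (\<Sum>k\<in>S i. (norm (fourier_coeff (?D i) k))\<^sup>2)"
        unfolding sum_distrib_left
      proof (rule sum_mono)
        fix k assume k: "k \<in> S i"
        define \<theta> where "\<theta> = real_of_int (k $ i) * h"
        have "\<bar>real_of_int (k $ i)\<bar> \<le> 2 * 2 ^ j * \<bar>l\<bar>"
          using k K(2) by (auto simp: S_def int_cube_def)
        then have "\<bar>\<theta>\<bar> \<le> 2" using l h(1) by (simp add: \<theta>_def h_def abs_mult divide_simps mult_ac)
        moreover have "1 \<le> \<bar>\<theta>\<bar>" using k h(1) by (simp add: \<theta>_def S_def abs_mult)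
        ultimately have "cos \<bar>\<theta>\<bar> \<le> cos 1" using pi_gt3 by (intro cos_monotone_0_pi_le) auto
        then have c: "cos \<theta> \<le> cos 1" by simp
        have "(norm (cis \<theta> - 1))\<^sup>2 = 2 - 2 * cos \<theta>"
          using sin_cos_squared_add[of \<theta>] by (simp add: cmod_power2 power2_diff)
        then have "2 - 2 * cos 1 \<le> (norm (cis \<theta> - 1))\<^sup>2" using c by simp
        then have "d \<le> ((norm (cis \<theta> - 1))\<^sup>2) ^ Suc n"
          unfolding d_def by (intro power_mono) auto
        also have "\<dots> = (norm ((cis \<theta> - 1) ^ Suc n))\<^sup>2"
          by (simp only: norm_power power_mult[symmetric] mult.commute)
        finally show "d * (norm (fourier_coeff (F l) k))\<^sup>2 \<le> (norm (fourier_coeff (?D i) k))\<^sup>2"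
          unfolding fc(3) norm_mult power_mult_distrib \<theta>_def by (intro mult_right_mono) auto
      qed
      also have "\<dots> \<le> torus_mean (\<lambda>t. (norm (?D i t))\<^sup>2)"
        by (rule bessel_torus[OF fc(1) S])
      also have "\<dots> \<le> torus_mean (\<lambda>t::real^'m. (C i * (\<bar>l\<bar> * h) powr (real n + \<alpha>))\<^sup>2)"
        by (intro torus_mean_mono power_mono C l h continuous_intros fc(1)) auto
      also have "\<dots> = (C i)\<^sup>2 * (2 ^ j) powr (- 2 * (real n + \<alpha>))"
      proof -
        have "((1 / 2 ^ j) powr (real n + \<alpha>))\<^sup>2 = ((2::real) ^ j) powr (- 2 * (real n + \<alpha>))"
          by (simp add: powr_divide powr_minus power2_eq_square divide_simps flip: powr_add)
        then show ?thesis by (simp add: h(4) power_mult_distrib)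
      qed
      finally show ?thesis .
    qed
    have "d * (\<Sum>k\<in>K. (norm (fourier_coeff (F l) k))\<^sup>2) \<le> d * (\<Sum>i\<in>UNIV. \<Sum>k\<in>S i. (norm (fourier_coeff (F l) k))\<^sup>2)"
    proof (intro mult_left_mono)
      have "(\<Sum>k\<in>K. (norm (fourier_coeff (F l) k))\<^sup>2)
          \<le> (\<Sum>k\<in>K. \<Sum>i\<in>UNIV. if k \<in> S i then (norm (fourier_coeff (F l) k))\<^sup>2 else 0)"
      proof (rule sum_mono)
        fix k assume "k \<in> K"
        then obtain i where i: "k \<in> S i" using cover by auto
        show "(norm (fourier_coeff (F l) k))\<^sup>2
            \<le> (\<Sum>i\<in>UNIV. if k \<in> S i then (norm (fourier_coeff (F l) k))\<^sup>2 else 0)"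
          using member_le_sum[of i UNIV "\<lambda>i. if k \<in> S i then (norm (fourier_coeff (F l) k))\<^sup>2 else 0"] i
          by simp
      qed
      also have "\<dots> = (\<Sum>i\<in>UNIV. \<Sum>k\<in>K. if k \<in> S i then (norm (fourier_coeff (F l) k))\<^sup>2 else 0)"
        by (rule sum.swap)
      also have "\<dots> = (\<Sum>i\<in>UNIV. \<Sum>k\<in>S i. (norm (fourier_coeff (F l) k))\<^sup>2)"
        unfolding sum.inter_restrict[OF K(1), symmetric]
        by (intro sum.cong refl) (auto simp: S_def)
      finally show "(\<Sum>k\<in>K. (norm (fourier_coeff (F l) k))\<^sup>2) \<le> (\<Sum>i\<in>UNIV. \<Sum>k\<in>S i. (norm (fourier_coeff (F l) k))\<^sup>2)" .
    qed (use d in simp)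
    also have "\<dots> \<le> (\<Sum>i\<in>UNIV. (C i)\<^sup>2 * (2 ^ j) powr (- 2 * (real n + \<alpha>)))"
      unfolding sum_distrib_left[of d _ UNIV] by (intro sum_mono each)
    finally show ?thesis using d by (simp add: divide_simps sum_distrib_right mult_ac)
  qed
  moreover have "0 \<le> (\<Sum>i\<in>UNIV. (C i)\<^sup>2) / d" using d by (simp add: sum_nonneg)
  ultimately show ?thesis by blast
qed

section \<open>Reduction to a fundamental domain\<close>

lemma torus_periodic_int_multiple:
  assumes "torus_periodic f"
  shows "f (x + (2 * pi * real_of_int n) *\<^sub>R axis i 1) = f x"
proof (cases n rule: int_cases2)
  case (nonneg n)
  have "f (x + (2 * pi * real n) *\<^sub>R axis i 1) = f x" for x
  proof (induction n arbitrary: x)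
    case (Suc n)
    have eq: "x + (2 * pi * real (Suc n)) *\<^sub>R axis i 1
        = (x + (2 * pi) *\<^sub>R axis i 1) + (2 * pi * real n) *\<^sub>R axis i 1"
      by (simp add: algebra_simps)
    show ?case unfolding eq Suc using assms unfolding torus_periodic_def by blast
  qed simp
  then show ?thesis using nonneg by simp
next
  case (nonpos n)
  have "f (x + (2 * pi * real n) *\<^sub>R axis i 1) = f x" for x
  proof (induction n arbitrary: x)
    case (Suc n)
    have eq: "x + (2 * pi * real (Suc n)) *\<^sub>R axis i 1
        = (x + (2 * pi) *\<^sub>R axis i 1) + (2 * pi * real n) *\<^sub>R axis i 1"
      by (simp add: algebra_simps)
    show ?case unfolding eq Suc using assms unfolding torus_periodic_def by blast
  qed simp
  from this[of "x - (2 * pi * real n) *\<^sub>R axis i 1"] show ?thesis using nonpos by simp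
qed

lemma torus_periodic_lattice:
  fixes f :: "real^'m \<Rightarrow> 'b"
  assumes "torus_periodic f"
  shows "f (x + (\<chi> i. 2 * pi * real_of_int (k i))) = f x"
proof -
  have "f (x + (\<Sum>i\<in>A. (2 * pi * real_of_int (k i)) *\<^sub>R axis i 1)) = f x" for A :: "'m set"
    using finite[of A]
  proof (induction A arbitrary: x)
    case (insert i A)
    then show ?case
      using torus_periodic_int_multiple[OF assms, of "x + (\<Sum>i\<in>A. (2 * pi * real_of_int (k i)) *\<^sub>R axis i 1)" "k i" i]
      by (simp add: add_ac)
  qed simp
  moreover have "(\<Sum>i\<in>UNIV. (2 * pi * real_of_int (k i)) *\<^sub>R axis i 1) = ((\<chi> i. 2 * pi * real_of_int (k i)) :: real^'m)"
    using basis_expansion[of "(\<chi> i. 2 * pi * real_of_int (k i)) :: real^'m"] by (simp add: scalar_mult_eq_scaleR)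
  ultimately show ?thesis by metis
qed

text \<open>The cube may be centred anywhere: with c = t0 the coordinates of y - t0 land in the
  range where |cis a - 1| is comparable to |a|.\<close>

lemma torus_representative:
  fixes x c :: "real^'m"
  obtains y k where "x = y + (\<chi> i. 2 * pi * real_of_int (k i))" "\<And>i. \<bar>y $ i - c $ i\<bar> \<le> pi"
proof -
  define k where "k i = \<lfloor>(x $ i - c $ i + pi) / (2 * pi)\<rfloor>" for i
  define y where "y = x - (\<chi> i. 2 * pi * real_of_int (k i))"
  have "\<bar>y $ i - c $ i\<bar> \<le> pi" for i
  proof -
    let ?r = "(x $ i - c $ i + pi) / (2 * pi)"
    have "real_of_int (k i) \<le> ?r" "?r \<le> real_of_int (k i) + 1" by (auto simp: k_def)
    then have "real_of_int (k i) * (2 * pi) \<le> x $ i - c $ i + pi"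
      "x $ i - c $ i + pi \<le> (real_of_int (k i) + 1) * (2 * pi)"
      by (simp_all add: pos_le_divide_eq pos_divide_le_eq)
    then show ?thesis by (simp add: y_def abs_le_iff algebra_simps)
  qed
  then show ?thesis using that[of y k] by (simp add: y_def)
qed

lemma torus_range_eq:
  assumes "torus_periodic f"
  shows "range f = f ` cbox (\<chi> i. - pi) (\<chi> i. pi)"
proof -
  have "f x \<in> f ` cbox (\<chi> i. - pi) (\<chi> i. pi)" for x
  proof -
    obtain y k where y: "x = y + (\<chi> i. 2 * pi * real_of_int (k i))" "\<And>i. \<bar>y $ i - 0 $ i\<bar> \<le> pi"
      using torus_representative[of x 0] by metis
    then have "f x = f y" using torus_periodic_lattice[OF assms] by simp
    moreover have "y \<in> cbox (\<chi> i. - pi) (\<chi> i. pi)"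
      using y(2) by (simp add: mem_box_cart abs_le_iff minus_le_iff)
    ultimately show ?thesis by blast
  qed
  then show ?thesis by auto
qed

lemma torus_continuous_compact:
  assumes "torus_periodic f" "continuous_on UNIV f"
  shows "compact (range f)"
  unfolding torus_range_eq[OF assms(1)]
  by (intro compact_continuous_image compact_cbox continuous_on_subset[OF assms(2)]) auto

lemma torus_continuous_bounded:
  fixes f :: "real^'m \<Rightarrow> 'b::real_normed_vector"
  assumes "torus_periodic f" "continuous_on UNIV f"
  obtains B where "\<And>x. norm (f x) \<le> B"
  using compact_imp_bounded[OF torus_continuous_compact[OF assms]] that by (auto simp: bounded_iff)

section \<open>Hoelder classes and the exponential as scaled families\<close>

lemma lipschitz_order_continuous:
  assumes "lipschitz_order \<alpha> g" "0 < \<alpha>"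
  shows "continuous_on UNIV g"
proof -
  obtain C where C: "\<And>x y. \<bar>g x - g y\<bar> \<le> C * dist x y powr \<alpha>"
    using assms(1) by (auto simp: lipschitz_order_def)
  have "(g \<longlongrightarrow> g x) (at x)" for x
  proof (rule LIM_zero_cancel, rule Lim_null_comparison)
    show "\<forall>\<^sub>F y in at x. norm (g y - g x) \<le> C * dist y x powr \<alpha>"
      using C by (auto intro: always_eventually)
    have "((\<lambda>y. C * dist y x powr \<alpha>) \<longlongrightarrow> C * dist x x powr \<alpha>) (at x)"
      using assms(2) by (intro tendsto_intros tendsto_powr') auto
    then show "((\<lambda>y. C * dist y x powr \<alpha>) \<longlongrightarrow> 0) (at x)" by simp
  qed
  then show ?thesis by (simp add: continuous_on_def)
qed

lemma holder_class_continuous: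
  assumes "0 \<le> \<alpha>" "holder_class n \<alpha> g"
  shows "continuous_on UNIV g"
proof (cases n)
  case 0
  then show ?thesis using assms lipschitz_order_continuous[of \<alpha> g] by (cases "\<alpha> = 0") auto
next
  case (Suc n)
  then show ?thesis using assms(2)
    by (auto intro!: differentiable_imp_continuous_on simp: differentiable_on_def)
qed

lemma line_derivative_gradient:
  fixes g :: "real^'m \<Rightarrow> real"
  assumes "g differentiable (at (x + s *\<^sub>R v))"
  shows "((\<lambda>s. g (x + s *\<^sub>R v)) has_real_derivative gradient_vec g (x + s *\<^sub>R v) \<bullet> v) (at s)"
proof -
  let ?y = "x + s *\<^sub>R v" and ?D = "frechet_derivative g (at (x + s *\<^sub>R v))"
  have D: "(g has_derivative ?D) (at ?y)" using assms frechet_derivative_works by blast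
  then have lin: "linear ?D" using has_derivative_linear by blast
  have "?D v = ?D (\<Sum>i\<in>UNIV. (v $ i) *\<^sub>R axis i 1)"
    using basis_expansion[of v] by (simp add: scalar_mult_eq_scaleR)
  also have "\<dots> = (\<Sum>i\<in>UNIV. v $ i * partial_deriv i g ?y)"
    by (simp add: linear_sum[OF lin] linear_scale[OF lin] partial_deriv_def)
  also have "\<dots> = gradient_vec g ?y \<bullet> v"
    by (simp add: inner_vec_def gradient_vec_def mult.commute)
  finally have Dv: "?D v = gradient_vec g ?y \<bullet> v" .
  have "((\<lambda>s. x + s *\<^sub>R v) has_derivative (\<lambda>r. r *\<^sub>R v)) (at s)"
    by (auto intro!: derivative_eq_intros)
  from has_derivative_compose[OF this D]
  have "((\<lambda>s. g (x + s *\<^sub>R v)) has_derivative (\<lambda>r. ?D (r *\<^sub>R v))) (at s)" .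
  then show ?thesis
    by (simp add: has_field_derivative_def linear_scale[OF lin] Dv mult.commute[of _ "gradient_vec g _ \<bullet> v"] mult_commute_abs)
qed

lemma partial_deriv_line:
  fixes g :: "real^'m \<Rightarrow> real"
  assumes "g differentiable (at x)"
  shows "((\<lambda>s. g (x + s *\<^sub>R axis i 1)) has_real_derivative partial_deriv i g x) (at 0)"
  using line_derivative_gradient[of g x 0 "axis i 1"] assms
  by (simp add: inner_axis gradient_vec_def)

text \<open>\<open>frechet_derivative\<close> chooses some derivative, so it agrees at two points as
  soon as the same maps are derivatives there; the chain rule with a translation gives this in both
  directions.\<close>

lemma torus_periodic_partial_deriv:
  assumes "torus_periodic g"
  shows "torus_periodic (partial_deriv i g)"
proof -
  have shift: "(g has_derivative D) (at x)"
    if c: "\<And>x. g (x + c) = g x" and D: "(g has_derivative D) (at (x + c))" for c x D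
  proof -
    have "((\<lambda>y. y + c) has_derivative (\<lambda>y. y)) (at x)" by (auto intro!: derivative_eq_intros)
    from has_derivative_compose[OF this D] show ?thesis by (simp add: c)
  qed
  have "(g has_derivative D) (at (x + c)) \<longleftrightarrow> (g has_derivative D) (at x)"
    if c: "\<And>x. g (x + c) = g x" for c x D
  proof
    assume "(g has_derivative D) (at x)"
    then show "(g has_derivative D) (at (x + c))"
      using shift[of "- c" D "x + c"] c[of "_ - c"] by simp
  qed (rule shift[OF c])
  then show ?thesis
    using assms unfolding torus_periodic_def partial_deriv_def frechet_derivative_def by simp
qed

text \<open>The factor c l is there for the induction: rescaling the derivative by l turns c l into
  c l / l, which is again at most 1 in modulus when \<bar>l\<bar> \<ge> 1.\<close>

lemma holder_class_scaled_smooth: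
  fixes g :: "real^'m \<Rightarrow> real"
  assumes \<alpha>: "0 \<le> \<alpha>"
  shows "holder_class n \<alpha> g \<Longrightarrow> torus_periodic g \<Longrightarrow> (\<And>l. 1 \<le> \<bar>l\<bar> \<Longrightarrow> \<bar>c l\<bar> \<le> 1)
    \<Longrightarrow> scaled_smooth n \<alpha> (axis i 1) (\<lambda>l x. complex_of_real (c l * g x))"
proof (induction n arbitrary: g c)
  case 0
  obtain B where B: "\<And>x. norm (g x) \<le> B"
    using torus_continuous_bounded[OF 0(2) holder_class_continuous[OF \<alpha> 0(1)]] by blast
  obtain C where C: "0 \<le> C" "\<And>x h. 0 < h \<Longrightarrow> \<bar>g (x + h *\<^sub>R axis i 1) - g x\<bar> \<le> C * h powr \<alpha>"
  proof (cases "\<alpha> = 0")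
    \<comment> \<open>For \<alpha> = 0 the class only gives continuity. As h powr 0 = 1 for h > 0,
      the estimate wanted is boundedness of the difference, and g is bounded by periodicity.\<close>
    case True
    have "\<bar>g (x + h *\<^sub>R axis i 1) - g x\<bar> \<le> 2 * B * h powr \<alpha>" if "0 < h" for x h
      using B[of "x + h *\<^sub>R axis i 1"] B[of x] that True by simp
    moreover have "0 \<le> 2 * B" using B[of 0] by simp
    ultimately show ?thesis using that by blast
  next
    case False
    then obtain C where "\<And>x y. \<bar>g x - g y\<bar> \<le> C * dist x y powr \<alpha>"
      using 0(1) by (auto simp: lipschitz_order_def)
    then have C: "\<bar>g (x + h *\<^sub>R axis i 1) - g x\<bar> \<le> C * dist (x + h *\<^sub>R axis i 1) x powr \<alpha>" for x h .
    have "\<bar>g (x + h *\<^sub>R axis i 1) - g x\<bar> \<le> \<bar>C\<bar> * h powr \<alpha>" if "0 < h" for x h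
    proof -
      have "dist (x + h *\<^sub>R axis i 1) x = h" using that by (simp add: dist_norm)
      then have "\<bar>g (x + h *\<^sub>R axis i 1) - g x\<bar> \<le> C * h powr \<alpha>" using C[of x h] by simp
      also have "\<dots> \<le> \<bar>C\<bar> * h powr \<alpha>" by (intro mult_right_mono) auto
      finally show ?thesis .
    qed
    then show ?thesis using that[of "\<bar>C\<bar>"] by auto
  qed
  show ?case
  proof (rule scaled_smooth_0I[where B = B and C = C])
    fix l :: real and x :: "real^'m" assume l: "1 \<le> \<bar>l\<bar>"
    have "\<bar>c l\<bar> * \<bar>g x\<bar> \<le> 1 * B" using 0(3)[OF l] B[of x] by (intro mult_mono) auto
    then show "norm (complex_of_real (c l * g x)) \<le> B" by (simp add: abs_mult norm_mult)
    fix h :: real assume h: "0 < h"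
    have "\<bar>c l\<bar> * \<bar>g (x + h *\<^sub>R axis i 1) - g x\<bar> \<le> 1 * (C * h powr \<alpha>)"
      using 0(3)[OF l] C(2)[OF h, of x] by (intro mult_mono) auto
    also have "\<dots> \<le> C * (\<bar>l\<bar> * h) powr \<alpha>"
    proof -
      have "1 * h \<le> \<bar>l\<bar> * h" using l h by (intro mult_right_mono) auto
      then have "h powr \<alpha> \<le> (\<bar>l\<bar> * h) powr \<alpha>" using \<alpha> h by (intro powr_mono2) auto
      then show ?thesis using C(1) by (simp add: mult_left_mono)
    qed
    finally show "norm (complex_of_real (c l * g (x + h *\<^sub>R axis i 1)) - complex_of_real (c l * g x))
      \<le> C * (\<bar>l\<bar> * h) powr \<alpha>"
      unfolding of_real_diff[symmetric] norm_of_real right_diff_distrib[symmetric] abs_mult .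
  qed
next
  case (Suc n)
  obtain B where B: "\<And>x. norm (g x) \<le> B"
    using torus_continuous_bounded[OF Suc.prems(2) holder_class_continuous[OF \<alpha> Suc.prems(1)]] by blast
  show ?case
  proof (rule scaled_smooth_SucI[where B = B and F' = "\<lambda>l x. complex_of_real ((c l / l) * partial_deriv i g x)"])
    fix l :: real and x :: "real^'m" assume l: "1 \<le> \<bar>l\<bar>"
    have "\<bar>c l\<bar> * \<bar>g x\<bar> \<le> 1 * B" using Suc.prems(3)[OF l] B[of x] by (intro mult_mono) auto
    then show "norm (complex_of_real (c l * g x)) \<le> B" by (simp add: abs_mult norm_mult)
    have "((\<lambda>s. c l * g (x + s *\<^sub>R axis i 1)) has_real_derivative c l * partial_deriv i g x) (at 0)"
      by (intro DERIV_cmult partial_deriv_line) (use Suc.prems(1) in simp)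
    then have "((\<lambda>s. complex_of_real (c l * g (x + s *\<^sub>R axis i 1))) has_vector_derivative
        complex_of_real (c l * partial_deriv i g x)) (at 0)"
      by (rule has_vector_derivative_of_real)
    moreover have "complex_of_real (c l * partial_deriv i g x) = l *\<^sub>R complex_of_real ((c l / l) * partial_deriv i g x)"
      using l by (auto simp: scaleR_conv_of_real)
    ultimately show "((\<lambda>s. complex_of_real (c l * g (x + s *\<^sub>R axis i 1))) has_vector_derivative
        l *\<^sub>R complex_of_real ((c l / l) * partial_deriv i g x)) (at 0)" by simp
  next
    show "scaled_smooth n \<alpha> (axis i 1) (\<lambda>l x. complex_of_real ((c l / l) * partial_deriv i g x))"
    proof (rule Suc.IH)
      show "holder_class n \<alpha> (partial_deriv i g)" using Suc.prems(1) by simp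
      show "torus_periodic (partial_deriv i g)" by (rule torus_periodic_partial_deriv[OF Suc.prems(2)])
      show "\<bar>c l / l\<bar> \<le> 1" if "1 \<le> \<bar>l\<bar>" for l
        using Suc.prems(3)[OF that] that by (simp add: divide_simps)
    qed
  qed
qed

lemma scaled_smooth_const:
  "scaled_smooth n \<alpha> e (\<lambda>l x. z)"
proof (induction n arbitrary: z)
  case 0
  show ?case by (rule scaled_smooth_0I[where B = "norm z" and C = 0]) auto
next
  case (Suc n)
  show ?case by (rule scaled_smooth_SucI[where B = "norm z" and F' = "\<lambda>l x. 0"]) (auto intro: Suc)
qed

text \<open>Bootstrapping: the derivative is l times \<i> times the partial derivative of g times
  the exponential itself. So order k for the exponential, with k \<le> n, and order n for the
  partial derivative give order k + 1 for the exponential.\<close>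

lemma scaled_smooth_exp:
  fixes g :: "real^'m \<Rightarrow> real"
  assumes \<alpha>: "0 \<le> \<alpha>" "\<alpha> \<le> 1" and g: "holder_class (Suc n) \<alpha> g" and per: "torus_periodic g"
  shows "scaled_smooth (Suc n) \<alpha> (axis i 1) (\<lambda>l x. exp (\<i> * complex_of_real (l * g x)))"
proof -
  let ?E = "\<lambda>l x. exp (\<i> * complex_of_real (l * g x))"
  let ?F' = "\<lambda>l x. (\<i> * complex_of_real (partial_deriv i g x)) * ?E l x"
  have bd: "norm (?E l x) \<le> 1" for l x by simp
  have der: "((\<lambda>s. ?E l (x + s *\<^sub>R axis i 1)) has_vector_derivative l *\<^sub>R ?F' l x) (at 0)" for l x
  proof -
    have "((\<lambda>s. l * g (x + s *\<^sub>R axis i 1)) has_real_derivative l * partial_deriv i g x) (at 0)"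
      by (intro DERIV_cmult partial_deriv_line) (use g in simp)
    then have "((\<lambda>s. \<i> * complex_of_real (l * g (x + s *\<^sub>R axis i 1))) has_vector_derivative
        \<i> * complex_of_real (l * partial_deriv i g x)) (at 0)"
      by (intro has_vector_derivative_mult_right has_vector_derivative_of_real)
    from field_vector_diff_chain_at[OF this DERIV_exp]
    show ?thesis by (simp add: o_def scaleR_conv_of_real mult_ac)
  qed
  have p: "scaled_smooth n \<alpha> (axis i 1) (\<lambda>l x. complex_of_real (partial_deriv i g x))"
    using holder_class_scaled_smooth[OF \<alpha>(1), of n "partial_deriv i g" "\<lambda>_. 1" i]
      g torus_periodic_partial_deriv[OF per] by simp
  have prod: "scaled_smooth k \<alpha> (axis i 1) ?F'" if "k \<le> n" "scaled_smooth k \<alpha> (axis i 1) ?E" for k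
    by (intro scaled_smooth_mult \<alpha> scaled_smooth_const that scaled_smooth_mono[OF \<alpha> p])
  have "k \<le> Suc n \<Longrightarrow> scaled_smooth k \<alpha> (axis i 1) ?E" for k
  proof (induction k)
    case 0
    obtain B where B: "\<And>(l::real) x. 1 \<le> \<bar>l\<bar> \<Longrightarrow> norm (complex_of_real (partial_deriv i g x)) \<le> B"
      by (rule scaled_smooth_bounded[OF p]) blast
    have bd': "norm (?F' l x) \<le> B" if "1 \<le> \<bar>l\<bar>" for l x
      using B[OF that, of x] by (simp add: norm_mult)
    show ?case by (rule scaled_smooth_0_of_derivative[OF \<alpha> bd bd' der])
  next
    case (Suc k)
    show ?case
      by (rule scaled_smooth_SucI[where B = 1, OF bd der prod]) (use Suc in auto)
  qed
  then show ?thesis by blast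
qed

text \<open>Stated for all finite K with one constant, so that summability of the whole family can
  be deduced from it.\<close>

lemma exp_coeff_sum_upper:
  fixes \<phi> :: "real^'m \<Rightarrow> real"
  assumes p: "0 \<le> p" "p \<le> 2" and \<alpha>: "0 \<le> \<alpha>" "\<alpha> \<le> 1"
    and per: "torus_periodic \<phi>" and holder: "holder_class (Suc n) \<alpha> \<phi>"
  defines "\<beta> \<equiv> real CARD('m) * (1 - p / 2)"
  assumes s: "\<beta> < (real (Suc n) + \<alpha>) * p"
  shows "\<exists>C>0. \<forall>l K. 1 \<le> \<bar>l\<bar> \<longrightarrow> finite K \<longrightarrow>
    (\<Sum>k\<in>K. norm (fourier_coeff (\<lambda>t. exp (\<i> * complex_of_real (l * \<phi> t))) k) powr p) \<le> C * \<bar>l\<bar> powr \<beta>"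
proof -
  let ?E = "\<lambda>l t. exp (\<i> * complex_of_real (l * \<phi> t))"
  define s where "s = real (Suc n) + \<alpha>"
  have cont: "continuous_on UNIV (?E l)" for l
    using holder_class_continuous[OF \<alpha>(1) holder] by (intro continuous_intros)
  have perE: "torus_periodic (?E l)" for l
    using torus_periodic_compose[OF per, of "\<lambda>r. exp (\<i> * complex_of_real (l * r))"] .
  obtain D0 where D0: "0 \<le> D0" "\<And>l j K. 1 \<le> \<bar>l\<bar> \<Longrightarrow> finite K
      \<Longrightarrow> K \<subseteq> int_cube (2 * 2 ^ j * \<bar>l\<bar>) - int_cube (2 ^ j * \<bar>l\<bar>)
      \<Longrightarrow> (\<Sum>k\<in>K. (norm (fourier_coeff (?E l) k))\<^sup>2) \<le> D0 * (2 ^ j) powr (- 2 * s)"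
    using fourier_square_sum_scaled_smooth[OF scaled_smooth_exp[OF \<alpha> holder per] cont perE]
    unfolding s_def by blast
  \<comment> \<open>Bessel's inequality for a function of modulus 1 bounds every square sum by 1,
    which covers the innermost cube; D0 covers the shells.\<close>
  define D where "D = max 1 D0"
  have total: "(\<Sum>k\<in>K. (norm (fourier_coeff (?E l) k))\<^sup>2) \<le> D" if "finite K" for l K
  proof -
    have "(\<Sum>k\<in>K. (norm (fourier_coeff (?E l) k))\<^sup>2) \<le> torus_mean (\<lambda>t. (norm (?E l t))\<^sup>2)"
      by (rule bessel_torus[OF cont that])
    also have "\<dots> = 1" by simp
    finally show ?thesis by (simp add: D_def)
  qed
  have shell: "(\<Sum>k\<in>K. (norm (fourier_coeff (?E l) k))\<^sup>2) \<le> D * (2 ^ j) powr (- 2 * s)"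
    if "1 \<le> \<bar>l\<bar>" "finite K" "K \<subseteq> int_cube (2 * 2 ^ j * \<bar>l\<bar>) - int_cube (2 ^ j * \<bar>l\<bar>)" for l j K
    by (rule order_trans[OF D0(2)[OF that]], rule mult_right_mono) (auto simp: D_def)
  let ?C = "(5 ^ CARD('m) + D) * (1 + 1 / (1 - 2 powr (\<beta> - s * p)))"
  have "2 powr (\<beta> - s * p) < 1" using assms(8) by (simp add: powr_less_one s_def)
  then have "0 < ?C" by (intro mult_pos_pos add_pos_nonneg) (auto simp: D_def)
  moreover have "(\<Sum>k\<in>K. norm (fourier_coeff (?E l) k) powr p) \<le> ?C * \<bar>l\<bar> powr \<beta>"
    if "1 \<le> \<bar>l\<bar>" "finite K" for l K
    using assms(8) unfolding \<beta>_def s_def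
    by (intro sum_powr_le_of_dyadic_decay p that total shell[unfolded s_def]) (auto simp: D_def)
  ultimately show ?thesis by blast
qed

section \<open>Lower bound\<close>

text \<open>Either n = 1 and \<alpha> = 1, where this is the definition of the class, or n \<ge> 2,
  where the second partial derivatives are continuous and periodic, hence bounded, and the mean
  value theorem on segments applies.\<close>

lemma partial_deriv_lipschitz:
  fixes \<phi> :: "real^'m \<Rightarrow> real"
  assumes \<alpha>: "0 \<le> \<alpha>" "\<alpha> \<le> 1" and per: "torus_periodic \<phi>"
    and holder: "holder_class n \<alpha> \<phi>" and n: "2 \<le> real n + \<alpha>"
  obtains C where "0 \<le> C" "\<And>i x y. \<bar>partial_deriv i \<phi> x - partial_deriv i \<phi> y\<bar> \<le> C * norm (x - y)"
proof -
  have "\<exists>C. \<forall>x y. \<bar>partial_deriv i \<phi> x - partial_deriv i \<phi> y\<bar> \<le> C * norm (x - y)" for i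
  proof -
    consider "n = 1" "\<alpha> = 1" | k where "n = Suc (Suc k)"
      using n \<alpha> by (cases n; cases "n - 1") auto
    then show ?thesis
    proof cases
      case 1
      then have "lipschitz_order 1 (partial_deriv i \<phi>)" using holder by simp
      then show ?thesis by (auto simp: lipschitz_order_def dist_norm)
    next
      case 2
      let ?g = "partial_deriv i \<phi>"
      have g: "holder_class (Suc k) \<alpha> ?g" using holder 2 by simp
      have perg: "torus_periodic ?g" by (rule torus_periodic_partial_deriv[OF per])
      have "\<exists>B. \<forall>x. norm (partial_deriv j ?g x) \<le> B" for j
      proof -
        have "holder_class k \<alpha> (partial_deriv j ?g)" using g by simp
        then show ?thesis
          using torus_continuous_bounded[OF torus_periodic_partial_deriv[OF perg] holder_class_continuous[OF \<alpha>(1)]] by metis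
      qed
      then obtain B where B: "\<And>j x. norm (partial_deriv j ?g x) \<le> B j" by metis
      let ?L = "\<Sum>j\<in>UNIV. B j"
      have L: "norm (gradient_vec ?g x) \<le> ?L" for x
        using norm_le_l1_cart[of "gradient_vec ?g x"] sum_mono[of UNIV "\<lambda>j. norm (partial_deriv j ?g x)" B] B
        by (simp add: gradient_vec_def)
      have "\<bar>?g x - ?g y\<bar> \<le> ?L * norm (x - y)" for x y
      proof -
        have "norm (?g (y + 1 *\<^sub>R (x - y)) - ?g (y + 0 *\<^sub>R (x - y))) \<le> (?L * norm (x - y)) * norm (1 - 0 :: real)"
        proof (rule field_differentiable_bound[OF convex_UNIV])
          show "((\<lambda>s. ?g (y + s *\<^sub>R (x - y))) has_field_derivative
              gradient_vec ?g (y + s *\<^sub>R (x - y)) \<bullet> (x - y)) (at s within UNIV)" for s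
            using line_derivative_gradient[of ?g y s "x - y"] g by simp
          show "norm (gradient_vec ?g (y + s *\<^sub>R (x - y)) \<bullet> (x - y)) \<le> ?L * norm (x - y)" for s
            using Cauchy_Schwarz_ineq2[of "gradient_vec ?g (y + s *\<^sub>R (x - y))" "x - y"]
              mult_right_mono[OF L[of "y + s *\<^sub>R (x - y)"], of "norm (x - y)"] by simp
        qed auto
        then show ?thesis by simp
      qed
      then show ?thesis by blast
    qed
  qed
  then obtain C where C: "\<And>i x y. \<bar>partial_deriv i \<phi> x - partial_deriv i \<phi> y\<bar> \<le> C i * norm (x - y)" by metis
  have "\<bar>partial_deriv i \<phi> x - partial_deriv i \<phi> y\<bar> \<le> (\<Sum>i\<in>UNIV. \<bar>C i\<bar>) * norm (x - y)" for i x y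
  proof -
    have "C i \<le> (\<Sum>i\<in>UNIV. \<bar>C i\<bar>)"
      using member_le_sum[of i UNIV "\<lambda>i. \<bar>C i\<bar>"] by simp
    then show ?thesis using C[of i x y] by (meson mult_right_mono norm_ge_zero order_trans)
  qed
  then show ?thesis using that[of "\<Sum>i\<in>UNIV. \<bar>C i\<bar>"] by (simp add: sum_nonneg)
qed

text \<open>The mean value theorem writes the increment with an intermediate gradient, which the
  Lipschitz bound compares with the gradient at x. The factor CARD('m) comes from bounding the
  Euclidean norm by the sum of the coordinates.\<close>

lemma gradient_taylor_quadratic:
  fixes \<phi> :: "real^'m \<Rightarrow> real"
  assumes diff: "\<And>x. \<phi> differentiable (at x)"
    and lip: "\<And>i x y. \<bar>partial_deriv i \<phi> x - partial_deriv i \<phi> y\<bar> \<le> C * norm (x - y)" and C: "0 \<le> C"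
  shows "\<bar>\<phi> y - \<phi> x - gradient_vec \<phi> x \<bullet> (y - x)\<bar> \<le> (real CARD('m) * C) * (norm (y - x))\<^sup>2"
proof -
  let ?v = "y - x"
  have "\<exists>z::real. 0 < z \<and> z < 1 \<and> \<phi> (x + 1 *\<^sub>R ?v) - \<phi> (x + 0 *\<^sub>R ?v)
      = (1 - 0) * (gradient_vec \<phi> (x + z *\<^sub>R ?v) \<bullet> ?v)"
    by (rule MVT2) (auto intro!: line_derivative_gradient diff)
  then obtain z where z: "0 < z" "z < 1" "\<phi> y - \<phi> x = gradient_vec \<phi> (x + z *\<^sub>R ?v) \<bullet> ?v" by auto
  have "norm (gradient_vec \<phi> (x + z *\<^sub>R ?v) - gradient_vec \<phi> x)
      \<le> (\<Sum>i\<in>UNIV. \<bar>(gradient_vec \<phi> (x + z *\<^sub>R ?v) - gradient_vec \<phi> x) $ i\<bar>)"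
    by (rule norm_le_l1_cart)
  also have "\<dots> \<le> (\<Sum>i\<in>(UNIV::'m set). C * norm ?v)"
  proof (rule sum_mono)
    fix i :: 'm
    have "\<bar>partial_deriv i \<phi> (x + z *\<^sub>R ?v) - partial_deriv i \<phi> x\<bar> \<le> C * norm (z *\<^sub>R ?v)"
      using lip[of i "x + z *\<^sub>R ?v" x] by simp
    also have "\<dots> \<le> C * norm ?v"
      using z C by (intro mult_left_mono) (auto simp: mult_left_le_one_le)
    finally show "\<bar>(gradient_vec \<phi> (x + z *\<^sub>R ?v) - gradient_vec \<phi> x) $ i\<bar> \<le> C * norm ?v"
      by (simp add: gradient_vec_def)
  qed
  finally have "norm (gradient_vec \<phi> (x + z *\<^sub>R ?v) - gradient_vec \<phi> x) * norm ?v
      \<le> (real CARD('m) * C * norm ?v) * norm ?v"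
    by (intro mult_right_mono) (auto simp: mult.assoc)
  moreover have "\<bar>\<phi> y - \<phi> x - gradient_vec \<phi> x \<bullet> ?v\<bar>
      \<le> norm (gradient_vec \<phi> (x + z *\<^sub>R ?v) - gradient_vec \<phi> x) * norm ?v"
    unfolding z(3) inner_diff_left[symmetric] by (rule Cauchy_Schwarz_ineq2)
  ultimately show ?thesis by (simp add: power2_eq_square mult.assoc)
qed

section \<open>Two-sided bounds for cis near 1\<close>

lemma norm_cis_minus_one: "norm (cis a - 1) = 2 * \<bar>sin (a / 2)\<bar>"
  using dist_exp_i_1[of a] by (simp add: cis_conv_exp)

lemma norm_cis_minus_one_le: "norm (cis a - 1) \<le> \<bar>a\<bar>"
  using abs_sin_x_le_abs_x[of "a / 2"] by (simp add: norm_cis_minus_one)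

text \<open>On [0, 1] the mean value theorem gives slope at least cos 1; on [1, pi/2] the sine is at
  least sin 1 while x < 2.\<close>

lemma sin_lower_linear:
  obtains \<kappa> :: real where "0 < \<kappa>" "\<And>x. 0 \<le> x \<Longrightarrow> x \<le> pi / 2 \<Longrightarrow> \<kappa> * x \<le> sin x"
proof -
  have c1: "0 < cos (1::real)" using pi_gt3 by (intro cos_gt_zero) auto
  have s1: "0 < sin (1::real)" using pi_gt3 by (intro sin_gt_zero) auto
  define \<kappa> where "\<kappa> = min (cos 1) (sin (1::real) / 2)"
  have "\<kappa> * x \<le> sin x" if x: "0 \<le> x" "x \<le> pi / 2" for x
  proof (cases "x \<le> 1")
    case True
    show ?thesis
    proof (cases "x = 0")
      case False
      then have "0 < x" using x by simp
      then have "\<exists>z>0. z < x \<and> sin x - sin 0 = (x - 0) * cos z"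
        by (intro MVT2) auto
      then obtain z where z: "0 < z" "z < x" "sin x = x * cos z" by auto
      have "cos 1 \<le> cos z" using z True pi_gt3 by (intro cos_monotone_0_pi_le) auto
      then have "\<kappa> \<le> cos z" by (simp add: \<kappa>_def)
      then show ?thesis using z x by (simp add: mult.commute mult_left_mono)
    qed simp
  next
    case False
    have "sin 1 \<le> sin x" using x False by (intro sin_monotone_2pi_le) auto
    moreover have "\<kappa> * x \<le> (sin 1 / 2) * 2"
      using x pi_less_4 s1 by (intro mult_mono) (auto simp: \<kappa>_def)
    ultimately show ?thesis by simp
  qed
  moreover have "0 < \<kappa>" using c1 s1 by (simp add: \<kappa>_def)
  ultimately show ?thesis using that by blast
qed

lemma cis_quadratic_lower:
  obtains \<kappa> :: real where "0 < \<kappa>" "\<And>a. \<bar>a\<bar> \<le> pi \<Longrightarrow> \<kappa> * a\<^sup>2 \<le> (norm (cis a - 1))\<^sup>2"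
proof -
  obtain \<kappa> :: real where \<kappa>: "0 < \<kappa>" "\<And>x. 0 \<le> x \<Longrightarrow> x \<le> pi / 2 \<Longrightarrow> \<kappa> * x \<le> sin x"
    using sin_lower_linear by blast
  have "\<kappa>\<^sup>2 * a\<^sup>2 \<le> (norm (cis a - 1))\<^sup>2" if "\<bar>a\<bar> \<le> pi" for a
  proof -
    have "\<kappa> * (\<bar>a\<bar> / 2) \<le> sin (\<bar>a\<bar> / 2)" using that by (intro \<kappa>) auto
    also have "\<dots> \<le> \<bar>sin (a / 2)\<bar>" by (cases "0 \<le> a") auto
    finally have "(\<kappa> * \<bar>a\<bar>)\<^sup>2 \<le> (norm (cis a - 1))\<^sup>2"
      unfolding norm_cis_minus_one using \<kappa>(1) by (intro power_mono) auto
    then show ?thesis by (simp add: power_mult_distrib)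
  qed
  then show ?thesis using that[of "\<kappa>\<^sup>2"] \<kappa>(1) by simp
qed

section \<open>The tent kernel and its moments\<close>

text \<open>The pyramid max 0 (2 M - |j|) in the maximum norm. A minimum over the coordinates,
  unlike a product, has one-step differences at most 1 in every dimension, and the values are still
  at least M on the cube of radius M.\<close>

definition tent :: "nat \<Rightarrow> int^'m \<Rightarrow> real" where
  "tent M j = Min (range (\<lambda>i. max 0 (2 * real M - \<bar>real_of_int (j $ i)\<bar>)))"

lemma tent_nonneg: "0 \<le> tent M j"
  unfolding tent_def by (subst Min_ge_iff) auto

lemma tent_le: "tent M j \<le> max 0 (2 * real M - \<bar>real_of_int (j $ i)\<bar>)"
  unfolding tent_def by (rule Min_le) auto

lemma tent_le_height: "tent M j \<le> 2 * real M"
  using tent_le[of M j undefined] by linarith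

lemma tent_ge: "j \<in> int_cube (real M) \<Longrightarrow> real M \<le> tent M j"
  unfolding tent_def by (subst Min_ge_iff) (auto simp: int_cube_def le_max_iff_disj)

lemma tent_eq_0: "2 * real M \<le> \<bar>real_of_int (j $ i)\<bar> \<Longrightarrow> tent M j = 0"
  using tent_le[of M j i] tent_nonneg[of M j] by simp

lemma Min_range_lipschitz:
  fixes f g :: "'a::finite \<Rightarrow> real"
  assumes "\<And>i. \<bar>f i - g i\<bar> \<le> e"
  shows "\<bar>Min (range f) - Min (range g)\<bar> \<le> e"
proof -
  have "Min (range f) \<le> Min (range g) + e" if "\<And>i. f i \<le> g i + e" for f g :: "'a \<Rightarrow> real"
  proof -
    have "Min (range g) \<in> range g" by (rule Min_in) auto
    then obtain i where i: "Min (range g) = g i" by (rule rangeE)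
    have "Min (range f) \<le> f i" by (rule Min_le) auto
    with i that[of i] show ?thesis by linarith
  qed
  from this[of f g] this[of g f] assms show ?thesis by (smt (verit))
qed

lemma tent_lipschitz: "\<bar>tent M j - tent M (j - axis i 1)\<bar> \<le> 1"
  unfolding tent_def
  by (rule Min_range_lipschitz) (auto simp: axis_def)

lemma parseval_translate:
  fixes t0 :: "real^'m"
  assumes "finite J"
  shows "torus_mean (\<lambda>t. (norm (\<Sum>j\<in>J. d j * char_torus j (t - t0)))\<^sup>2) = (\<Sum>j\<in>J. (norm (d j))\<^sup>2)"
proof -
  have "(\<Sum>j\<in>J. d j * char_torus j (t - t0)) = (\<Sum>j\<in>J. (d j * char_torus j (- t0)) * char_torus j t)" for t
    using char_torus_add_right[of _ t "- t0"] by (simp add: mult_ac)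
  then show ?thesis
    using parseval_trig_poly[OF assms, of "\<lambda>j. d j * char_torus j (- t0)"] by (simp add: norm_mult)
qed

text \<open>
  The kernel is \<open>\<bar>tent_poly M\<bar>\<^sup>2\<close>. Its second moments are controlled through Parseval's identity:
  multiplying \<open>tent_poly M\<close> by \<open>1 - cis (t $ i)\<close> differences its coefficients, which are 1-Lipschitz.
\<close>

definition tent_poly :: "nat \<Rightarrow> real^'m \<Rightarrow> complex" where
  "tent_poly M t = (\<Sum>j\<in>int_cube (2 * real M). complex_of_real (tent M j) * char_torus j t)"

lemma finite_int_cube [simp]: "finite (int_cube (2 * real M) :: (int^'m) set)"
  by (rule card_int_cube_le) simp

lemma card_int_cube_double:
  "real (card (int_cube (2 * real M) :: (int^'m) set)) = (4 * real M + 1) ^ CARD('m)"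
proof -
  have "2 * real M = real (2 * M)" by simp
  then have "card (int_cube (2 * real M) :: (int^'m) set) = (2 * (2 * M) + 1) ^ CARD('m)"
    using card_int_cube_of_nat(2)[of "2 * M"] by metis
  then have "real (card (int_cube (2 * real M) :: (int^'m) set)) = real (2 * (2 * M) + 1) ^ CARD('m)"
    by (simp only: of_nat_power)
  then show ?thesis by (simp add: algebra_simps)
qed

text \<open>Multiplying by cis (t $ i) shifts the index by one. No boundary term appears because the
  tent already vanishes where some coordinate has modulus 2 M: its support, shifted by one, still
  lies in the cube.\<close>

lemma tent_poly_mult_diff:
  fixes t :: "real^'m"
  shows "tent_poly M t * (1 - cis (t $ i))
    = (\<Sum>j\<in>int_cube (2 * real M). complex_of_real (tent M j - tent M (j - axis i 1)) * char_torus j t)"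
proof -
  let ?J = "int_cube (2 * real M) :: (int^'m) set" and ?e = "axis i 1 :: int^'m"
  have int_le: "\<bar>real_of_int a\<bar> < 2 * real M \<Longrightarrow> \<bar>real_of_int (a + 1)\<bar> \<le> 2 * real M" for a
  proof -
    assume "\<bar>real_of_int a\<bar> < 2 * real M"
    then have "real_of_int \<bar>a\<bar> < real_of_int (2 * int M)" by simp
    then have "\<bar>a\<bar> < 2 * int M" by (simp only: of_int_less_iff)
    then have "\<bar>a + 1\<bar> \<le> 2 * int M" by linarith
    then have "real_of_int \<bar>a + 1\<bar> \<le> real_of_int (2 * int M)" by (simp only: of_int_le_iff)
    then show ?thesis by simp
  qed
  have bound: "\<bar>real_of_int (j $ l)\<bar> < 2 * real M" if "tent M j \<noteq> 0" for j :: "int^'m" and l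
    using tent_eq_0[of M j l] that by linarith
  have in1: "j \<in> ?J" if "tent M j \<noteq> 0" for j
    using bound[OF that] by (auto simp: int_cube_def less_imp_le)
  have in2: "j \<in> ?J" if "tent M (j - ?e) \<noteq> 0" for j
    unfolding int_cube_def mem_Collect_eq
  proof
    fix l
    have "(j - ?e) $ l = j $ l \<or> (j - ?e) $ l = j $ l - 1" by (auto simp: axis_def)
    then show "\<bar>real_of_int (j $ l)\<bar> \<le> 2 * real M"
      using bound[OF that, of l] int_le[of "j $ l - 1"] by auto
  qed
  have "tent_poly M t * cis (t $ i) = (\<Sum>j\<in>?J. complex_of_real (tent M j) * char_torus (j + ?e) t)"
    by (simp add: tent_poly_def sum_distrib_right char_torus_add_left char_torus_axis_left mult.assoc)
  also have "\<dots> = (\<Sum>j\<in>(\<lambda>j. j + ?e) ` ?J. complex_of_real (tent M (j - ?e)) * char_torus j t)"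
    by (subst sum.reindex) (auto simp: inj_on_def)
  also have "\<dots> = (\<Sum>j\<in>?J. complex_of_real (tent M (j - ?e)) * char_torus j t)"
  proof (rule sum.mono_neutral_cong)
    show "complex_of_real (tent M (j - ?e)) * char_torus j t = 0" if j: "j \<in> ?J - (\<lambda>j. j + ?e) ` ?J" for j
    proof -
      have "j - ?e \<notin> ?J" using j by (metis DiffD2 diff_add_cancel image_eqI)
      then show ?thesis using in1[of "j - ?e"] by auto
    qed
    show "complex_of_real (tent M (j - ?e)) * char_torus j t = 0" if j: "j \<in> (\<lambda>j. j + ?e) ` ?J - ?J" for j
      using in2[of j] j by auto
  qed auto
  finally show ?thesis
    unfolding right_diff_distrib by (simp add: tent_poly_def left_diff_distrib sum_subtractf)
qed

lemma tent_poly_mean_square: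
  fixes t0 :: "real^'m"
  shows "torus_mean (\<lambda>t. (norm (tent_poly M (t - t0)))\<^sup>2) = (\<Sum>j\<in>int_cube (2 * real M). (tent M (j :: int^'m))\<^sup>2)"
  unfolding tent_poly_def by (subst parseval_translate) simp_all

text \<open>Coefficient differences of modulus at most 1 leave one unit per lattice point. Against
  the mean square, which is at least M^2 (2 M + 1)^m by \<open>tent_square_sum_ge\<close>, this is
  smaller by a factor of order M^2: the kernel lives at distance 1/M from t0 modulo periods, in the
  sense of second moments.\<close>

lemma tent_poly_second_moment:
  fixes t0 :: "real^'m"
  shows "torus_mean (\<lambda>t. (norm (cis ((t - t0) $ i) - 1))\<^sup>2 * (norm (tent_poly M (t - t0)))\<^sup>2) \<le> (4 * real M + 1) ^ CARD('m)"
proof -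
  let ?J = "int_cube (2 * real M) :: (int^'m) set"
  have "(norm (cis ((t - t0) $ i) - 1))\<^sup>2 * (norm (tent_poly M (t - t0)))\<^sup>2
     = (norm (\<Sum>j\<in>?J. complex_of_real (tent M j - tent M (j - axis i 1)) * char_torus j (t - t0)))\<^sup>2" for t
    unfolding tent_poly_mult_diff[symmetric] norm_mult power_mult_distrib
    by (simp add: norm_minus_commute mult.commute)
  then have "torus_mean (\<lambda>t. (norm (cis ((t - t0) $ i) - 1))\<^sup>2 * (norm (tent_poly M (t - t0)))\<^sup>2)
     = (\<Sum>j\<in>?J. (norm (complex_of_real (tent M j - tent M (j - axis i 1))))\<^sup>2)"
    by (simp only: parseval_translate finite_int_cube)
  also have "\<dots> \<le> (\<Sum>j\<in>?J. 1)"
    using tent_lipschitz by (intro sum_mono) (auto simp: abs_square_le_1 simp del: of_real_diff)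
  also have "\<dots> = (4 * real M + 1) ^ CARD('m)" by (simp add: card_int_cube_double)
  finally show ?thesis .
qed

lemma tent_square_sum_ge:
  "real M ^ 2 * (2 * real M + 1) ^ CARD('m) \<le> (\<Sum>j\<in>int_cube (2 * real M). (tent M (j :: int^'m))\<^sup>2)"
proof -
  let ?I = "int_cube (real M) :: (int^'m) set"
  have "real M ^ 2 * (2 * real M + 1) ^ CARD('m) = (\<Sum>j\<in>?I. real M ^ 2)"
    by (simp add: card_int_cube_of_nat(2) algebra_simps)
  also have "\<dots> \<le> (\<Sum>j\<in>?I. (tent M j)\<^sup>2)"
    by (intro sum_mono power_mono tent_ge) auto
  also have "\<dots> \<le> (\<Sum>j\<in>int_cube (2 * real M). (tent M (j :: int^'m))\<^sup>2)"
    by (rule sum_mono2[OF finite_int_cube]) (auto simp: int_cube_def intro: order_trans)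
  finally show ?thesis .
qed

lemma continuous_on_tent_poly [continuous_intros]: "continuous_on S (tent_poly M)"
  unfolding tent_poly_def[abs_def] by (intro continuous_intros)

section \<open>Testing a function against the kernel\<close>

text \<open>Expanding the squared modulus, the pair j, l contributes the coefficient at k - j + l.
  The base point only enters through \<open>char_torus (k - j + l) t0\<close>, of modulus 1, which
  the triangle inequality discards.\<close>

lemma mean_against_tent_kernel_le:
  fixes f :: "real^'m \<Rightarrow> complex"
  assumes f: "continuous_on UNIV f"
  shows "norm (torus_mean (\<lambda>t. f t * cnj (char_torus k (t - t0)) * complex_of_real ((norm (tent_poly M (t - t0)))\<^sup>2)))
    \<le> (\<Sum>j\<in>int_cube (2 * real M). \<Sum>l\<in>int_cube (2 * real M). tent M j * tent M l * norm (fourier_coeff f (k - j + l)))"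
proof -
  let ?J = "int_cube (2 * real M) :: (int^'m) set"
  let ?u = "\<lambda>j l. complex_of_real (tent M j * tent M l) * char_torus (k - j + l) t0"
  have expand: "f t * cnj (char_torus k (t - t0)) * complex_of_real ((norm (tent_poly M (t - t0)))\<^sup>2)
      = (\<Sum>j\<in>?J. \<Sum>l\<in>?J. ?u j l * (f t * cnj (char_torus (k - j + l) t)))" for t
  proof -
    have "f t * cnj (char_torus k (t - t0)) * complex_of_real ((norm (tent_poly M (t - t0)))\<^sup>2)
       = (\<Sum>j\<in>?J. \<Sum>l\<in>?J. f t * cnj (char_torus k (t - t0))
           * ((complex_of_real (tent M j) * char_torus j (t - t0)) * cnj (complex_of_real (tent M l) * char_torus l (t - t0))))"
      unfolding complex_norm_square tent_poly_def cnj_sum sum_product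
      unfolding sum_distrib_left by (rule refl)
    also have "\<dots> = (\<Sum>j\<in>?J. \<Sum>l\<in>?J. ?u j l * (f t * cnj (char_torus (k - j + l) t)))"
    proof (intro sum.cong refl)
      fix j l
      have "cnj (char_torus k (t - t0)) * char_torus j (t - t0) * cnj (char_torus l (t - t0))
         = cnj (char_torus (k - j + l) (t - t0))"
        unfolding cnj_char_torus char_torus_add_left[symmetric] by (simp add: algebra_simps)
      also have "\<dots> = cnj (char_torus (k - j + l) t) * char_torus (k - j + l) t0"
        using char_torus_add_right[of "k - j + l" t "- t0"] cnj_char_torus_right[of "k - j + l" "- t0"]
        by simp
      finally have "cnj (char_torus k (t - t0)) * char_torus j (t - t0) * cnj (char_torus l (t - t0))
         = cnj (char_torus (k - j + l) t) * char_torus (k - j + l) t0" .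
      moreover have "f t * cnj (char_torus k (t - t0))
           * ((complex_of_real (tent M j) * char_torus j (t - t0)) * cnj (complex_of_real (tent M l) * char_torus l (t - t0)))
         = complex_of_real (tent M j * tent M l) * f t
           * (cnj (char_torus k (t - t0)) * char_torus j (t - t0) * cnj (char_torus l (t - t0)))"
        by (simp add: mult_ac)
      ultimately show "f t * cnj (char_torus k (t - t0))
           * ((complex_of_real (tent M j) * char_torus j (t - t0)) * cnj (complex_of_real (tent M l) * char_torus l (t - t0)))
         = ?u j l * (f t * cnj (char_torus (k - j + l) t))"
        by (simp add: mult_ac)
    qed
    finally show ?thesis .
  qed
  have cont: "continuous_on UNIV (\<lambda>t. f t * cnj (char_torus a t))" for a
    by (intro continuous_intros f)
  have "torus_mean (\<lambda>t. \<Sum>j\<in>?J. \<Sum>l\<in>?J. ?u j l * (f t * cnj (char_torus (k - j + l) t)))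
     = (\<Sum>j\<in>?J. torus_mean (\<lambda>t. \<Sum>l\<in>?J. ?u j l * (f t * cnj (char_torus (k - j + l) t))))"
    by (rule torus_mean_sum) (auto intro!: continuous_intros cont)
  also have "\<dots> = (\<Sum>j\<in>?J. \<Sum>l\<in>?J. torus_mean (\<lambda>t. ?u j l * (f t * cnj (char_torus (k - j + l) t))))"
    by (intro sum.cong refl torus_mean_sum) (auto intro!: continuous_intros cont)
  also have "\<dots> = (\<Sum>j\<in>?J. \<Sum>l\<in>?J. ?u j l * fourier_coeff f (k - j + l))"
    unfolding fourier_coeff_eq_mean by (intro sum.cong refl torus_mean_mult_left cont)
  finally have eq: "torus_mean (\<lambda>t. f t * cnj (char_torus k (t - t0)) * complex_of_real ((norm (tent_poly M (t - t0)))\<^sup>2))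
     = (\<Sum>j\<in>?J. \<Sum>l\<in>?J. ?u j l * fourier_coeff f (k - j + l))"
    unfolding expand .
  show ?thesis
    unfolding eq
    by (intro sum_norm_le) (auto simp: norm_mult abs_of_nonneg tent_nonneg mult_ac)
qed

text \<open>Let A be the mean of the kernel. Replacing g by the constant w of modulus 1 costs at
  most A / 8 from the constant in \<open>close\<close> and 3 A / 8 from the second moments, so half
  of A remains.\<close>

lemma mean_against_tent_kernel_ge:
  fixes g :: "real^'m \<Rightarrow> complex"
  assumes g: "continuous_on UNIV g" and w: "norm w = 1" and B: "0 \<le> B"
    and close: "\<And>t. norm (g t - w) \<le> 1 / 8 + B * (\<Sum>i\<in>UNIV. (norm (cis ((t - t0) $ i) - 1))\<^sup>2)"
    and M: "B * real CARD('m) * (4 * real M + 1) ^ CARD('m) \<le> 3 / 8 * (\<Sum>j\<in>int_cube (2 * real M). (tent M (j :: int^'m))\<^sup>2)"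
  shows "(\<Sum>j\<in>int_cube (2 * real M). (tent M (j :: int^'m))\<^sup>2) / 2
    \<le> norm (torus_mean (\<lambda>t. g t * complex_of_real ((norm (tent_poly M (t - t0)))\<^sup>2)))"
proof -
  let ?A = "\<Sum>j\<in>int_cube (2 * real M). (tent M (j :: int^'m))\<^sup>2"
  let ?K = "\<lambda>t. (norm (tent_poly M (t - t0)))\<^sup>2"
  have cP: "continuous_on UNIV (\<lambda>t. tent_poly M (t - t0))"
    by (rule continuous_on_compose2[OF continuous_on_tent_poly[of UNIV]]) (auto intro!: continuous_intros)
  have ci: "continuous_on UNIV (\<lambda>t. cis ((t - t0) $ i))" for i by (intro continuous_intros)
  have cK: "continuous_on UNIV ?K" by (intro continuous_intros cP)
  have cK': "continuous_on UNIV (\<lambda>t. complex_of_real (?K t))" by (intro continuous_intros cP)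
  have "torus_mean (\<lambda>t. w * complex_of_real (?K t)) = w * torus_mean (\<lambda>t. complex_of_real (?K t))"
    by (rule torus_mean_mult_left[OF cK'])
  also have "torus_mean (\<lambda>t. complex_of_real (?K t)) = complex_of_real (torus_mean ?K)"
    by (rule torus_mean_bounded_linear[OF cK bounded_linear_of_real])
  finally have wK: "norm (torus_mean (\<lambda>t. w * complex_of_real (?K t))) = ?A"
    using w by (simp add: tent_poly_mean_square norm_mult sum_nonneg del: of_real_sum)
  have "norm (torus_mean (\<lambda>t. (g t - w) * complex_of_real (?K t)))
      \<le> torus_mean (\<lambda>t. 1 / 8 * ?K t + (\<Sum>i\<in>UNIV. B * ((norm (cis ((t - t0) $ i) - 1))\<^sup>2 * ?K t)))"
  proof (rule norm_torus_mean_le)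
    fix t
    have "norm (g t - w) * ?K t \<le> (1 / 8 + B * (\<Sum>i\<in>UNIV. (norm (cis ((t - t0) $ i) - 1))\<^sup>2)) * ?K t"
      by (intro mult_right_mono close) auto
    then show "norm ((g t - w) * complex_of_real (?K t))
        \<le> 1 / 8 * ?K t + (\<Sum>i\<in>UNIV. B * ((norm (cis ((t - t0) $ i) - 1))\<^sup>2 * ?K t))"
      by (simp add: norm_mult norm_power distrib_right sum_distrib_left sum_distrib_right mult.assoc)
  qed (intro continuous_intros g cP ci)+
  also have "\<dots> = torus_mean (\<lambda>t. 1 / 8 * ?K t) + torus_mean (\<lambda>t. \<Sum>i\<in>UNIV. B * ((norm (cis ((t - t0) $ i) - 1))\<^sup>2 * ?K t))"
    by (rule torus_mean_add) (intro continuous_intros cP ci)+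
  also have "torus_mean (\<lambda>t. 1 / 8 * ?K t) = 1 / 8 * ?A"
    unfolding torus_mean_mult_left[OF cK] tent_poly_mean_square ..
  also have "torus_mean (\<lambda>t. \<Sum>i\<in>UNIV. B * ((norm (cis ((t - t0) $ i) - 1))\<^sup>2 * ?K t))
      = (\<Sum>i\<in>UNIV. torus_mean (\<lambda>t. B * ((norm (cis ((t - t0) $ i) - 1))\<^sup>2 * ?K t)))"
    by (rule torus_mean_sum) (auto intro!: continuous_intros cP ci)
  also have "\<dots> = (\<Sum>i\<in>UNIV. B * torus_mean (\<lambda>t. (norm (cis ((t - t0) $ i) - 1))\<^sup>2 * ?K t))"
    by (intro sum.cong refl torus_mean_mult_left continuous_intros cP ci)
  also have "\<dots> \<le> (\<Sum>i\<in>(UNIV::'m set). B * (4 * real M + 1) ^ CARD('m))"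
    by (intro sum_mono mult_left_mono tent_poly_second_moment B)
  also have "\<dots> \<le> 3 / 8 * ?A" using M by (simp add: mult_ac)
  finally have diff: "norm (torus_mean (\<lambda>t. (g t - w) * complex_of_real (?K t))) \<le> ?A / 2" by simp
  have "torus_mean (\<lambda>t. g t * complex_of_real (?K t))
      = torus_mean (\<lambda>t. (g t - w) * complex_of_real (?K t) + w * complex_of_real (?K t))"
    by (simp add: algebra_simps)
  also have "\<dots> = torus_mean (\<lambda>t. (g t - w) * complex_of_real (?K t)) + torus_mean (\<lambda>t. w * complex_of_real (?K t))"
    by (rule torus_mean_add) (intro continuous_intros g cP)+
  finally show ?thesis
    using norm_diff_ineq[of "torus_mean (\<lambda>t. w * complex_of_real (?K t))" "torus_mean (\<lambda>t. (g t - w) * complex_of_real (?K t))"]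
      wK diff by (simp add: add.commute)
qed

section \<open>From a convolution bound to a count of frequencies\<close>

text \<open>Counterpart of \<open>powr_le_threshold_square\<close> with the exponents 1 and p in
  place of p and 2.\<close>

lemma le_threshold_powr:
  fixes x \<tau> p :: real
  assumes "0 \<le> x" "0 < \<tau>" "1 \<le> p"
  shows "x \<le> \<tau> + \<tau> powr (1 - p) * x powr p"
proof (cases "x \<le> \<tau>")
  case True
  then show ?thesis by (simp add: add_increasing2)
next
  case False
  then have x: "0 < x" using assms by linarith
  have "x = x powr (1 - p) * x powr p"
    using x by (simp flip: powr_add)
  also have "\<dots> \<le> \<tau> powr (1 - p) * x powr p"
    using assms False by (intro mult_right_mono powr_mono2') auto
  finally show ?thesis using assms by linarith
qed

text \<open>For each k the threshold \<tau> accounts for \<tau> (sum c J)^2, at most half of A. The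
  rest is paid by p-th powers: for fixed j and l these run over a translate of S and sum to at most
  T.\<close>

lemma card_powr_le_of_convolution:
  fixes a :: "'a::ab_group_add \<Rightarrow> real"
  assumes a: "\<And>k. 0 \<le> a k" and c: "\<And>j. 0 \<le> c j" and J: "finite J" and S: "finite S" and p: "1 \<le> p"
    and W: "0 < sum c J" and \<tau>: "0 < \<tau>" "2 * \<tau> * (sum c J)\<^sup>2 \<le> A"
    and low: "\<And>k. k \<in> S \<Longrightarrow> A \<le> (\<Sum>j\<in>J. \<Sum>l\<in>J. c j * c l * a (k - j + l))"
    and total: "\<And>K. finite K \<Longrightarrow> (\<Sum>k\<in>K. a k powr p) \<le> T"
  shows "real (card S) * \<tau> powr p \<le> T"
proof -
  define W where "W = (sum c J)\<^sup>2"
  have W_eq: "W = (\<Sum>j\<in>J. \<Sum>l\<in>J. c j * c l)" by (simp add: W_def power2_eq_square sum_product)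
  have Wpos: "0 < W" using W by (simp add: W_def)
  have "real (card S) * (2 * \<tau> * W) \<le> (\<Sum>k\<in>S. A)"
    using \<tau>(2) by (simp add: W_def mult_left_mono)
  also have "\<dots> \<le> (\<Sum>k\<in>S. \<Sum>j\<in>J. \<Sum>l\<in>J. c j * c l * a (k - j + l))"
    by (intro sum_mono low)
  also have "\<dots> \<le> (\<Sum>k\<in>S. \<Sum>j\<in>J. \<Sum>l\<in>J. c j * c l * (\<tau> + \<tau> powr (1 - p) * a (k - j + l) powr p))"
    by (intro sum_mono mult_left_mono le_threshold_powr mult_nonneg_nonneg a c \<tau> p)
  also have "\<dots> = real (card S) * (\<tau> * W)
      + (\<Sum>k\<in>S. \<Sum>j\<in>J. \<Sum>l\<in>J. c j * c l * \<tau> powr (1 - p) * a (k - j + l) powr p)"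
    by (simp add: W_eq distrib_left sum.distrib sum_distrib_left mult_ac)
  also have "(\<Sum>k\<in>S. \<Sum>j\<in>J. \<Sum>l\<in>J. c j * c l * \<tau> powr (1 - p) * a (k - j + l) powr p)
      = (\<Sum>j\<in>J. \<Sum>l\<in>J. c j * c l * \<tau> powr (1 - p) * (\<Sum>k\<in>S. a (k - j + l) powr p))"
    unfolding sum_distrib_left by (subst sum.swap, rule sum.cong[OF refl], rule sum.swap)
  also have "\<dots> \<le> (\<Sum>j\<in>J. \<Sum>l\<in>J. c j * c l * \<tau> powr (1 - p) * T)"
  proof (intro sum_mono mult_left_mono)
    fix j l
    have "(\<Sum>k\<in>S. a (k - j + l) powr p) = (\<Sum>k\<in>(\<lambda>k. k - j + l) ` S. a k powr p)"
      by (subst sum.reindex) (auto simp: inj_on_def)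
    also have "\<dots> \<le> T" using S by (intro total) auto
    finally show "(\<Sum>k\<in>S. a (k - j + l) powr p) \<le> T" .
  qed (use c in auto)
  also have "\<dots> = W * (\<tau> powr (1 - p) * T)"
    by (simp add: W_eq sum_distrib_right mult.assoc)
  finally have "W * (real (card S) * \<tau>) \<le> W * (\<tau> powr (1 - p) * T)"
    by (simp add: algebra_simps)
  then have "real (card S) * \<tau> \<le> \<tau> powr (1 - p) * T" using Wpos by simp
  then have "\<tau> powr (p - 1) * (real (card S) * \<tau>) \<le> \<tau> powr (p - 1) * (\<tau> powr (1 - p) * T)"
    by (rule mult_left_mono) simp
  also have "\<dots> = T" using \<tau> by (simp flip: powr_add add: mult.assoc[symmetric])
  also have "\<tau> powr (p - 1) * (real (card S) * \<tau>) = real (card S) * \<tau> powr p"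
    using \<tau> by (simp add: powr_diff)
  finally show ?thesis .
qed

text \<open>The dilate of R by l is covered by the unit cubes whose lower corners are the points of
  S, so its volume is at most the number of these cubes.\<close>

lemma card_lattice_floor_ge_measure:
  fixes R :: "(real^'m) set" and l :: real
  assumes R: "compact R"
  defines "S \<equiv> (\<lambda>x. \<chi> i. \<lfloor>l * x $ i\<rfloor>) ` R"
  shows "finite S" "\<bar>l\<bar> ^ CARD('m) * measure lebesgue R \<le> real (card S)"
proof -
  obtain B where B: "\<And>x. x \<in> R \<Longrightarrow> norm x \<le> B"
    using compact_imp_bounded[OF R] by (auto simp: bounded_iff)
  have "S \<subseteq> int_cube (\<bar>l\<bar> * \<bar>B\<bar> + 1)"
  proof
    fix k assume "k \<in> S"
    then obtain x where x: "x \<in> R" "k = (\<chi> i. \<lfloor>l * x $ i\<rfloor>)" by (auto simp: S_def)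
    have "\<bar>real_of_int \<lfloor>l * x $ i\<rfloor>\<bar> \<le> \<bar>l\<bar> * \<bar>B\<bar> + 1" for i
    proof -
      have "\<bar>l * x $ i\<bar> \<le> \<bar>l\<bar> * \<bar>B\<bar>"
        using component_le_norm_cart[of x i] B[OF x(1)] unfolding abs_mult by (intro mult_left_mono) auto
      then show ?thesis by linarith
    qed
    then show "k \<in> int_cube (\<bar>l\<bar> * \<bar>B\<bar> + 1)" by (simp add: x(2) int_cube_def)
  qed
  then show fin: "finite S" by (rule finite_subset) (rule card_int_cube_le, simp)
  let ?Q = "\<lambda>k. cbox (\<chi> i. real_of_int (k $ i)) (\<chi> i. real_of_int (k $ i) + 1) :: (real^'m) set"
  have sub: "(\<lambda>x. l *\<^sub>R x + 0) ` R \<subseteq> (\<Union>k\<in>S. ?Q k)"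
  proof
    fix y assume "y \<in> (\<lambda>x. l *\<^sub>R x + 0) ` R"
    then obtain x where x: "x \<in> R" "y = l *\<^sub>R x" by auto
    then have "y \<in> ?Q (\<chi> i. \<lfloor>l * x $ i\<rfloor>)" by (auto simp: mem_box_cart less_imp_le)
    then show "y \<in> (\<Union>k\<in>S. ?Q k)" using x(1) by (auto simp: S_def)
  qed
  have "measure lebesgue (?Q k) = 1" for k
  proof -
    have "measure lborel (?Q k) = 1"
      by (subst content_cbox_cart) (auto simp: interval_ne_empty_cart)
    then show ?thesis by simp
  qed
  then have Q: "measure lebesgue (\<Union>k\<in>S. ?Q k) \<le> real (card S)"
    using measure_UNION_le[OF fin, of ?Q lebesgue] by simp
  have "\<bar>l\<bar> ^ CARD('m) * measure lebesgue R = measure lebesgue ((\<lambda>x. l *\<^sub>R x + 0) ` R)"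
    using measure_lebesgue_affine[of l 0 R] by simp
  also have "\<dots> \<le> measure lebesgue (\<Union>k\<in>S. ?Q k)"
  proof (rule measure_mono_fmeasurable[OF sub])
    have "compact ((\<lambda>x. l *\<^sub>R x + 0) ` R)"
      by (intro compact_continuous_image R continuous_intros)
    then show "(\<lambda>x. l *\<^sub>R x + 0) ` R \<in> sets lebesgue" using lmeasurable_compact by blast
    show "(\<Union>k\<in>S. ?Q k) \<in> lmeasurable" using fin by (intro fmeasurable.finite_UN) auto
  qed
  also note Q
  finally show "\<bar>l\<bar> ^ CARD('m) * measure lebesgue R \<le> real (card S)" .
qed

section \<open>Plane wave approximation and the lower bound\<close>

text \<open>At distance d from t0 the phase has two errors: the Taylor remainder, at most
  \<bar>l\<bar> C d^2, and the rounding of l times the gradient to k, at most m d \<le> 1/8 + 2 m^2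
  d^2. Expressing the bound through cis in place of d makes both sides periodic in t, so that t may
  be replaced by a representative near t0.\<close>

lemma exp_close_to_plane_wave:
  fixes \<phi> :: "real^'m \<Rightarrow> real" and l :: real and t0 :: "real^'m"
  assumes per: "torus_periodic \<phi>" and C: "0 \<le> C"
    and taylor: "\<And>x y. \<bar>\<phi> y - \<phi> x - gradient_vec \<phi> x \<bullet> (y - x)\<bar> \<le> C * (norm (y - x))\<^sup>2"
    and \<kappa>: "0 < \<kappa>" "\<And>a. \<bar>a\<bar> \<le> pi \<Longrightarrow> \<kappa> * a\<^sup>2 \<le> (norm (cis a - 1))\<^sup>2"
    and l: "1 \<le> \<bar>l\<bar>"
  defines "k \<equiv> (\<chi> i. \<lfloor>l * gradient_vec \<phi> t0 $ i\<rfloor>) :: int^'m"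
  shows "norm (exp (\<i> * complex_of_real (l * \<phi> t)) * cnj (char_torus k (t - t0)) - exp (\<i> * complex_of_real (l * \<phi> t0)))
    \<le> 1 / 8 + ((C + 2 * (real CARD('m))\<^sup>2) / \<kappa> * \<bar>l\<bar>) * (\<Sum>i\<in>UNIV. (norm (cis ((t - t0) $ i) - 1))\<^sup>2)"
proof -
  define m where "m = real CARD('m)"
  define f where "f t = exp (\<i> * complex_of_real (l * \<phi> t)) * cnj (char_torus k (t + - t0))" for t
  define w where "w = exp (\<i> * complex_of_real (l * \<phi> t0))"
  \<comment> \<open>This is cis ((t - t0) $ i), written as a character so that its periodicity is at
    hand.\<close>
  define h where "h i t = char_torus (axis i 1) (t + - t0)" for i :: 'm and t :: "real^'m"
  have perf: "torus_periodic f" unfolding f_def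
    by (intro torus_periodic_mult torus_periodic_compose[OF per, of "\<lambda>r. exp (\<i> * complex_of_real (l * r))"]
        torus_periodic_compose[of _ cnj] torus_periodic_translate torus_periodic_char)
  have perh: "torus_periodic (h i)" for i
    unfolding h_def by (intro torus_periodic_translate torus_periodic_char)
  obtain y n where y: "t = y + (\<chi> i. 2 * pi * real_of_int (n i))" "\<And>i. \<bar>y $ i - t0 $ i\<bar> \<le> pi"
    using torus_representative[of t t0] by metis
  let ?d = "y - t0"
  define \<theta> where "\<theta> = l * \<phi> y - l * \<phi> t0 - (\<Sum>i\<in>UNIV. real_of_int (k $ i) * ?d $ i)"
  have "f y = w * cis \<theta>"
    unfolding f_def w_def \<theta>_def char_torus_def cis_cnj cis_conv_exp[symmetric] cis_mult by simp
  then have "f y - w = w * (cis \<theta> - 1)" by (simp add: algebra_simps)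
  then have 1: "norm (f y - w) \<le> \<bar>\<theta>\<bar>"
    using norm_cis_minus_one_le[of \<theta>] by (simp add: norm_mult w_def)
  have \<theta>: "\<theta> = l * (\<phi> y - \<phi> t0 - gradient_vec \<phi> t0 \<bullet> ?d)
      + (\<Sum>i\<in>UNIV. (l * gradient_vec \<phi> t0 $ i - real_of_int (k $ i)) * ?d $ i)"
  proof -
    have "(\<Sum>i\<in>UNIV. (l * gradient_vec \<phi> t0 $ i - real_of_int (k $ i)) * ?d $ i)
        = l * (gradient_vec \<phi> t0 \<bullet> ?d) - (\<Sum>i\<in>UNIV. real_of_int (k $ i) * ?d $ i)"
      unfolding left_diff_distrib sum_subtractf by (simp add: inner_vec_def sum_distrib_left mult.assoc)
    then show ?thesis unfolding \<theta>_def right_diff_distrib by linarith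
  qed
  have "\<bar>\<Sum>i\<in>UNIV. (l * gradient_vec \<phi> t0 $ i - real_of_int (k $ i)) * ?d $ i\<bar> \<le> (\<Sum>i\<in>(UNIV::'m set). norm ?d)"
  proof (rule order_trans[OF sum_abs], rule sum_mono)
    fix i :: 'm
    have "\<bar>l * gradient_vec \<phi> t0 $ i - real_of_int (k $ i)\<bar> \<le> 1"
      by (simp add: k_def abs_le_iff) linarith
    then have "\<bar>l * gradient_vec \<phi> t0 $ i - real_of_int (k $ i)\<bar> * \<bar>?d $ i\<bar> \<le> 1 * norm ?d"
      by (intro mult_mono component_le_norm_cart) auto
    then show "\<bar>(l * gradient_vec \<phi> t0 $ i - real_of_int (k $ i)) * ?d $ i\<bar> \<le> norm ?d"
      by (simp add: abs_mult)
  qed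
  also have "\<dots> = m * norm ?d" by (simp add: m_def)
  also have "\<dots> \<le> 1 / 8 + 2 * m\<^sup>2 * (norm ?d)\<^sup>2" \<comment> \<open>AM-GM\<close>
    using zero_le_power2[of "4 * (m * norm ?d) - 1"] by (simp add: power2_diff power_mult_distrib)
  also have "2 * m\<^sup>2 * (norm ?d)\<^sup>2 \<le> \<bar>l\<bar> * (2 * m\<^sup>2 * (norm ?d)\<^sup>2)"
    using l mult_right_mono[of 1 "\<bar>l\<bar>" "2 * m\<^sup>2 * (norm ?d)\<^sup>2"] by simp
  finally have 2: "\<bar>\<Sum>i\<in>UNIV. (l * gradient_vec \<phi> t0 $ i - real_of_int (k $ i)) * ?d $ i\<bar>
      \<le> 1 / 8 + \<bar>l\<bar> * (2 * m\<^sup>2 * (norm ?d)\<^sup>2)" by simp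
  have 3: "\<bar>l * (\<phi> y - \<phi> t0 - gradient_vec \<phi> t0 \<bullet> ?d)\<bar> \<le> \<bar>l\<bar> * (C * (norm ?d)\<^sup>2)"
    unfolding abs_mult by (intro mult_left_mono taylor) auto
  have "\<bar>\<theta>\<bar> \<le> 1 / 8 + (C + 2 * m\<^sup>2) * \<bar>l\<bar> * (norm ?d)\<^sup>2"
    using 2 3 unfolding \<theta> by (simp add: algebra_simps)
  also have "(norm ?d)\<^sup>2 \<le> (\<Sum>i\<in>UNIV. (norm (cis (?d $ i) - 1))\<^sup>2) / \<kappa>"
  proof -
    have "(norm ?d)\<^sup>2 = (\<Sum>i\<in>UNIV. (?d $ i)\<^sup>2)"
      by (simp add: norm_vec_def L2_set_def sum_nonneg)
    then have "\<kappa> * (norm ?d)\<^sup>2 \<le> (\<Sum>i\<in>UNIV. (norm (cis (?d $ i) - 1))\<^sup>2)"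
      using \<kappa>(2) y(2) by (simp add: sum_distrib_left sum_mono)
    then show ?thesis using \<kappa>(1) by (simp add: pos_le_divide_eq mult.commute)
  qed
  finally have "norm (f y - w) \<le> 1 / 8 + (C + 2 * m\<^sup>2) * \<bar>l\<bar> * ((\<Sum>i\<in>UNIV. (norm (cis (?d $ i) - 1))\<^sup>2) / \<kappa>)"
    using 1 C by (simp add: mult_left_mono)
  then have y_le: "norm (f y - w) \<le> 1 / 8 + ((C + 2 * m\<^sup>2) / \<kappa> * \<bar>l\<bar>) * (\<Sum>i\<in>UNIV. (norm (h i y - 1))\<^sup>2)"
    by (simp add: h_def char_torus_axis_left)
  have "f t = f y" "h i t = h i y" for i
    unfolding y(1) by (simp_all only: torus_periodic_lattice[OF perf] torus_periodic_lattice[OF perh])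
  then have "norm (f t - w) \<le> 1 / 8 + ((C + 2 * m\<^sup>2) / \<kappa> * \<bar>l\<bar>) * (\<Sum>i\<in>UNIV. (norm (h i t - 1))\<^sup>2)"
    using y_le by simp
  then show ?thesis by (simp add: f_def w_def h_def m_def char_torus_axis_left)
qed

text \<open>T is any common bound for the finite partial sums; the infinite sum will be substituted
  for it.\<close>

lemma exp_coeff_sum_lower:
  fixes \<phi> :: "real^'m \<Rightarrow> real"
  assumes p: "1 \<le> p" and \<alpha>: "0 \<le> \<alpha>" "\<alpha> \<le> 1"
    and per: "torus_periodic \<phi>" and holder: "holder_class \<nu> \<alpha> \<phi>" and \<nu>: "2 \<le> real \<nu> + \<alpha>"
    and image: "0 < emeasure lebesgue (range (gradient_vec \<phi>))"
  defines "\<beta> \<equiv> real CARD('m) * (1 - p / 2)"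
  shows "\<exists>c>0. \<forall>l T. 1 \<le> \<bar>l\<bar> \<longrightarrow>
    (\<forall>K. finite K \<longrightarrow> (\<Sum>k\<in>K. norm (fourier_coeff (\<lambda>t. exp (\<i> * complex_of_real (l * \<phi> t))) k) powr p) \<le> T)
    \<longrightarrow> c * \<bar>l\<bar> powr \<beta> \<le> T"
proof -
  define m where "m = real CARD('m)"
  have m: "1 \<le> m" by (simp add: m_def Suc_leI)
  obtain n where n: "\<nu> = Suc n" using \<nu> \<alpha> by (cases \<nu>) auto
  have diff: "\<phi> differentiable (at x)" for x using holder n by simp
  obtain C0 where C0: "0 \<le> C0" "\<And>i x y. \<bar>partial_deriv i \<phi> x - partial_deriv i \<phi> y\<bar> \<le> C0 * norm (x - y)"
    using partial_deriv_lipschitz[OF \<alpha> per holder \<nu>] by blast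
  define C where "C = m * C0"
  have C: "0 \<le> C" using C0 m by (simp add: C_def)
  have taylor: "\<bar>\<phi> y - \<phi> x - gradient_vec \<phi> x \<bullet> (y - x)\<bar> \<le> C * (norm (y - x))\<^sup>2" for x y
    unfolding C_def m_def by (rule gradient_taylor_quadratic[OF diff C0(2,1)])
  obtain \<kappa> :: real where \<kappa>: "0 < \<kappa>" "\<And>a. \<bar>a\<bar> \<le> pi \<Longrightarrow> \<kappa> * a\<^sup>2 \<le> (norm (cis a - 1))\<^sup>2"
    using cis_quadratic_lower by blast

  define R where "R = range (gradient_vec \<phi>)"
  have "continuous_on UNIV (partial_deriv i \<phi>)" for i
    using holder n by (auto intro: holder_class_continuous[OF \<alpha>(1)])
  then have "continuous_on UNIV (gradient_vec \<phi>)"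
    unfolding gradient_vec_def[abs_def] by (intro continuous_intros)
  moreover have "torus_periodic (gradient_vec \<phi>)"
    using torus_periodic_partial_deriv[OF per] by (simp add: torus_periodic_def gradient_vec_def)
  ultimately have R: "compact R" unfolding R_def by (intro torus_continuous_compact)
  \<comment> \<open>Compactness makes the measure of the gradient range finite, so that it can be
    handled as a positive real.\<close>
  define V where "V = measure lebesgue R"
  have "emeasure lebesgue R = ennreal V"
    unfolding V_def using lmeasurable_compact[OF R] by (simp add: emeasure_eq_measure2 fmeasurableD2)
  then have V: "0 < V" using image by (simp add: R_def)

  define B0 where "B0 = (C + 2 * m\<^sup>2) / \<kappa>"
  have B0: "0 \<le> B0" using C \<kappa> by (simp add: B0_def)
  \<comment> \<open>As A0 \<ge> 1, also A0^2 \<ge> A0 > 3 B0 m 2^m. Hence M \<ge> A0 sqrt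
    \<bar>l\<bar> makes the second moments small enough for
    \<open>mean_against_tent_kernel_ge\<close>; this is the fact \<open>small\<close>.\<close>
  define A0 where "A0 = 1 + 3 * B0 * m * 2 ^ CARD('m)"
  have A0: "1 \<le> A0" using B0 m by (simp add: A0_def)
  \<comment> \<open>The factor (6 A0)^m offsets (2 M + 1)^m, since 2 M + 1 \<le> 3 M \<le> 6 A0 sqrt
    \<bar>l\<bar>. The factor 16 * 4^m is what is left over when the squared sum of the weights is
    compared with the lower bound \<open>low\<close>.\<close>
  define c0 where "c0 = 1 / (16 * 4 ^ CARD('m) * (6 * A0) ^ CARD('m))"
  have c0: "0 < c0" using A0 by (simp add: c0_def)

  have main: "V * c0 powr p * \<bar>l\<bar> powr \<beta> \<le> T"
    if l: "1 \<le> \<bar>l\<bar>"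
      and T: "\<And>K. finite K \<Longrightarrow> (\<Sum>k\<in>K. norm (fourier_coeff (\<lambda>t. exp (\<i> * complex_of_real (l * \<phi> t))) k) powr p) \<le> T"
    for l T
  proof -
    define r where "r = sqrt \<bar>l\<bar>"
    have r: "1 \<le> r" "r\<^sup>2 = \<bar>l\<bar>" "r ^ CARD('m) = \<bar>l\<bar> powr (m / 2)"
    proof -
      show r1: "1 \<le> r" using l by (simp add: r_def)
      show "r\<^sup>2 = \<bar>l\<bar>" by (simp add: r_def)
      have "r = \<bar>l\<bar> powr (1 / 2)" by (simp add: r_def powr_half_sqrt)
      then have "r powr m = \<bar>l\<bar> powr (m / 2)" by (simp add: powr_powr)
      then show "r ^ CARD('m) = \<bar>l\<bar> powr (m / 2)" using r1 by (simp add: m_def powr_realpow)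
    qed
    define M where "M = nat \<lceil>A0 * r\<rceil>"
    have "1 * 1 \<le> A0 * r" using A0 r by (intro mult_mono) auto
    then have M: "A0 * r \<le> real M" "real M \<le> 2 * (A0 * r)" "1 \<le> real M"
      unfolding M_def by linarith+
    let ?D = "(2 * real M + 1) ^ CARD('m)" and ?J = "int_cube (2 * real M) :: (int^'m) set"
    have D: "0 < ?D" by (intro zero_less_power) simp
    have four: "(4 * real M + 1) ^ CARD('m) \<le> 2 ^ CARD('m) * ?D"
      unfolding power_mult_distrib[symmetric] by (intro power_mono) auto
    let ?A = "\<Sum>j\<in>?J. (tent M j)\<^sup>2"
    have A: "real M ^ 2 * ?D \<le> ?A" by (rule tent_square_sum_ge)
    have small: "(B0 * \<bar>l\<bar>) * real CARD('m) * (4 * real M + 1) ^ CARD('m) \<le> 3 / 8 * ?A"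
    proof -
      have "(B0 * \<bar>l\<bar>) * m * (4 * real M + 1) ^ CARD('m) \<le> (B0 * \<bar>l\<bar>) * m * (2 ^ CARD('m) * ?D)"
        using B0 m by (intro mult_left_mono four) auto
      also have "\<dots> = (B0 * m * 2 ^ CARD('m)) * \<bar>l\<bar> * ?D" by (simp add: mult_ac)
      also have "\<dots> \<le> (3 / 8 * A0\<^sup>2) * r\<^sup>2 * ?D"
      proof -
        have "A0 * 1 \<le> A0 * A0" using A0 by (intro mult_left_mono) auto
        moreover have "0 \<le> B0 * m * 2 ^ CARD('m)" using B0 m by simp
        moreover have "A0 = 1 + 3 * (B0 * m * 2 ^ CARD('m))" by (simp add: A0_def)
        ultimately have "B0 * m * 2 ^ CARD('m) \<le> 3 / 8 * A0\<^sup>2"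
          unfolding power2_eq_square by linarith
        then show ?thesis using D unfolding r(2) by (intro mult_right_mono) auto
      qed
      also have "\<dots> = 3 / 8 * ((A0 * r)\<^sup>2 * ?D)" by (simp add: power_mult_distrib mult_ac)
      also have "\<dots> \<le> 3 / 8 * (real M ^ 2 * ?D)"
        using M(1) A0 r D by (intro mult_left_mono mult_right_mono power_mono) auto
      also have "\<dots> \<le> 3 / 8 * ?A" using A by simp
      finally show ?thesis by (simp add: m_def)
    qed

    define S where "S = (\<lambda>x. \<chi> i. \<lfloor>l * x $ i\<rfloor>) ` R"
    have S: "finite S" "\<bar>l\<bar> ^ CARD('m) * V \<le> real (card S)"
      unfolding S_def V_def by (rule card_lattice_floor_ge_measure[OF R])+
    let ?a = "\<lambda>k. norm (fourier_coeff (\<lambda>t. exp (\<i> * complex_of_real (l * \<phi> t))) k)"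
    have low: "real M ^ 2 * ?D / 2 \<le> (\<Sum>i\<in>?J. \<Sum>j\<in>?J. tent M i * tent M j * ?a (k - i + j))" if kS: "k \<in> S" for k
    proof -
      \<comment> \<open>Each k in S has its own base point; the bound obtained from it no longer
        mentions it.\<close>
      obtain t0 where k: "k = (\<chi> i. \<lfloor>l * gradient_vec \<phi> t0 $ i\<rfloor>)" using kS unfolding S_def R_def image_image by blast
      let ?E = "\<lambda>t. exp (\<i> * complex_of_real (l * \<phi> t))"
      have cE: "continuous_on UNIV ?E"
        using holder_class_continuous[OF \<alpha>(1) holder] by (intro continuous_intros)
      have cg: "continuous_on UNIV (\<lambda>t. ?E t * cnj (char_torus k (t - t0)))"
        by (intro continuous_intros cE continuous_on_compose2[OF continuous_on_char_torus[of UNIV]]) auto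
      have "?A / 2 \<le> norm (torus_mean (\<lambda>t. (?E t * cnj (char_torus k (t - t0))) * complex_of_real ((norm (tent_poly M (t - t0)))\<^sup>2)))"
      proof (rule mean_against_tent_kernel_ge[OF cg])
        show "norm (?E t0) = 1" by simp
        show "0 \<le> B0 * \<bar>l\<bar>" using B0 by simp
        show "norm (?E t * cnj (char_torus k (t - t0)) - ?E t0)
            \<le> 1 / 8 + B0 * \<bar>l\<bar> * (\<Sum>i\<in>UNIV. (norm (cis ((t - t0) $ i) - 1))\<^sup>2)" for t
          unfolding k B0_def m_def by (rule exp_close_to_plane_wave[OF per C taylor \<kappa> l])
      qed (rule small)
      also have "\<dots> \<le> (\<Sum>i\<in>?J. \<Sum>j\<in>?J. tent M i * tent M j * ?a (k - i + j))"
        by (rule mean_against_tent_kernel_le[OF cE])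
      finally show ?thesis using A by simp
    qed

    \<comment> \<open>Up to a constant, the size of each coefficient if a unit square sum were
      spread evenly over \<bar>l\<bar>^m frequencies.\<close>
    define \<tau> where "\<tau> = c0 / r ^ CARD('m)"
    have \<tau>: "0 < \<tau>" using c0 r(1) by (simp add: \<tau>_def)
    have \<tau>D: "16 * 4 ^ CARD('m) * (\<tau> * ?D) \<le> 1"
    proof -
      have "?D \<le> (6 * A0 * r) ^ CARD('m)" using M by (intro power_mono) auto
      then have "\<tau> * ?D \<le> \<tau> * (6 * A0 * r) ^ CARD('m)" using \<tau> by (intro mult_left_mono) auto
      also have "\<dots> = 1 / (16 * 4 ^ CARD('m))"
        using r(1) A0 by (simp add: \<tau>_def c0_def power_mult_distrib)
      finally show ?thesis by (simp add: pos_le_divide_eq mult.commute)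
    qed
    have sum_le: "sum (tent M) ?J \<le> 2 * real M * (2 ^ CARD('m) * ?D)"
    proof -
      have "sum (tent M) ?J \<le> (\<Sum>j\<in>?J. 2 * real M)" by (intro sum_mono tent_le_height)
      also have "\<dots> = 2 * real M * (4 * real M + 1) ^ CARD('m)" by (simp add: card_int_cube_double)
      also have "\<dots> \<le> 2 * real M * (2 ^ CARD('m) * ?D)" by (intro mult_left_mono four) auto
      finally show ?thesis .
    qed
    have sum_pos: "0 < sum (tent M) ?J"
    proof -
      have "(0 :: int^'m) \<in> int_cube (real M)" by (simp add: int_cube_def)
      then have "0 < tent M (0 :: int^'m)" using tent_ge[of "0 :: int^'m" M] M(3) by linarith
      moreover have "(0 :: int^'m) \<in> ?J" by (simp add: int_cube_def)
      ultimately show ?thesis by (intro sum_pos2[of ?J 0]) (auto simp: tent_nonneg)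
    qed
    have "2 * \<tau> * (sum (tent M) ?J)\<^sup>2 \<le> 2 * \<tau> * (2 * real M * (2 ^ CARD('m) * ?D))\<^sup>2"
      using sum_le sum_pos \<tau> by (intro mult_left_mono power_mono) auto
    also have "\<dots> = (16 * 4 ^ CARD('m) * (\<tau> * ?D)) * (real M ^ 2 * ?D / 2)"
    proof -
      have "((2::real) ^ CARD('m))\<^sup>2 = 4 ^ CARD('m)" by (simp add: power2_eq_square flip: power_mult_distrib)
      then show ?thesis by (simp add: power_mult_distrib) (simp add: power2_eq_square mult_ac)
    qed
    also have "\<dots> \<le> 1 * (real M ^ 2 * ?D / 2)" using \<tau>D D by (intro mult_right_mono) auto
    finally have cond: "2 * \<tau> * (sum (tent M) ?J)\<^sup>2 \<le> real M ^ 2 * ?D / 2" by simp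
    have "real (card S) * \<tau> powr p \<le> T"
      by (rule card_powr_le_of_convolution[where a = ?a, OF norm_ge_zero tent_nonneg finite_int_cube S(1) p sum_pos \<tau> cond low T])
    moreover have "\<bar>l\<bar> ^ CARD('m) * V * \<tau> powr p \<le> real (card S) * \<tau> powr p"
      using S(2) by (intro mult_right_mono) auto
    moreover have "\<bar>l\<bar> ^ CARD('m) * V * \<tau> powr p = V * c0 powr p * \<bar>l\<bar> powr \<beta>"
    proof -
      have "\<tau> powr p = c0 powr p * \<bar>l\<bar> powr (- m / 2 * p)"
        using c0 l by (simp add: \<tau>_def r(3) powr_divide powr_powr powr_minus divide_simps)
      moreover have "\<bar>l\<bar> ^ CARD('m) * \<bar>l\<bar> powr (- m / 2 * p) = \<bar>l\<bar> powr \<beta>"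
      proof -
        have "\<bar>l\<bar> ^ CARD('m) = \<bar>l\<bar> powr m" using l by (simp add: m_def powr_realpow)
        then show ?thesis by (simp add: \<beta>_def m_def algebra_simps flip: powr_add)
      qed
      ultimately show ?thesis by (simp add: mult_ac)
    qed
    ultimately show ?thesis by linarith
  qed
  have "0 < V * c0 powr p" using V c0 by simp
  with main show ?thesis by blast
qed

section \<open>The two-sided estimate\<close>

theorem theorem4:
  fixes \<phi> :: "real^'m \<Rightarrow> real" and p \<alpha> :: real and \<nu> :: nat
  assumes "1 \<le> p" "p < 2" "0 \<le> \<alpha>" "\<alpha> \<le> 1"
    and "torus_periodic \<phi>"
    and "holder_class \<nu> \<alpha> \<phi>"
    and "emeasure lebesgue (range (gradient_vec \<phi>)) > 0"
    and "real \<nu> + \<alpha> \<ge> 2"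
    and "real \<nu> + \<alpha> > real CARD('m) * (1 / p - 1 / 2)"
  shows "\<exists>c1 c2. c1 > 0 \<and> c2 > 0 \<and>
    (\<forall>\<^sub>F lam in at_infinity.
       Ap_summable p (\<lambda>t. exp (\<i> * complex_of_real (lam * \<phi> t))) \<and>
       c1 \<le> Ap_norm p (\<lambda>t. exp (\<i> * complex_of_real (lam * \<phi> t))) / \<bar>lam\<bar> powr (real CARD('m) * (1 / p - 1 / 2)) \<and>
       Ap_norm p (\<lambda>t. exp (\<i> * complex_of_real (lam * \<phi> t))) / \<bar>lam\<bar> powr (real CARD('m) * (1 / p - 1 / 2)) \<le> c2)"
proof -
  let ?E = "\<lambda>lam t. exp (\<i> * complex_of_real (lam * \<phi> t))"
  let ?a = "\<lambda>lam k. norm (fourier_coeff (?E lam) k) powr p"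
  \<comment> \<open>\<gamma> is the exponent of the norm, \<beta> that of the sum of p-th
    powers.\<close>
  define \<gamma> where "\<gamma> = real CARD('m) * (1 / p - 1 / 2)"
  define \<beta> where "\<beta> = real CARD('m) * (1 - p / 2)"
  have \<gamma>p: "\<gamma> * p = \<beta>" using assms(1) by (simp add: \<gamma>_def \<beta>_def field_simps)
  obtain n where n: "\<nu> = Suc n" using assms(4,8) by (cases \<nu>) auto
  have s: "\<beta> < (real (Suc n) + \<alpha>) * p"
    unfolding \<gamma>p[symmetric] using assms(1,9) n by (intro mult_strict_right_mono) (auto simp: \<gamma>_def)
  obtain C where C: "0 < C" "\<And>lam K. 1 \<le> \<bar>lam\<bar> \<Longrightarrow> finite K \<Longrightarrow> sum (?a lam) K \<le> C * \<bar>lam\<bar> powr \<beta>"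
    using exp_coeff_sum_upper[of p \<alpha> \<phi> n] assms s unfolding n \<beta>_def by auto
  obtain c where c: "0 < c" "\<And>lam T. 1 \<le> \<bar>lam\<bar> \<Longrightarrow> (\<And>K. finite K \<Longrightarrow> sum (?a lam) K \<le> T) \<Longrightarrow> c * \<bar>lam\<bar> powr \<beta> \<le> T"
    using exp_coeff_sum_lower[OF assms(1,3,4,5,6,8,7)] unfolding \<beta>_def by blast
  have bounds: "Ap_summable p (?E lam) \<and> c powr (1 / p) \<le> Ap_norm p (?E lam) / \<bar>lam\<bar> powr \<gamma>
      \<and> Ap_norm p (?E lam) / \<bar>lam\<bar> powr \<gamma> \<le> C powr (1 / p)" if lam: "1 \<le> \<bar>lam\<bar>" for lam
  proof -
    have summable: "?a lam summable_on UNIV"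
      by (rule nonneg_bdd_above_summable_on, simp, rule bdd_aboveI2, rule C(2)[OF lam]) simp
    let ?I = "infsum (?a lam) UNIV"
    have up: "?I \<le> C * \<bar>lam\<bar> powr \<beta>"
      by (rule infsum_le_finite_sums[OF summable], rule C(2)[OF lam])
    have lo: "c * \<bar>lam\<bar> powr \<beta> \<le> ?I"
      by (rule c(2)[OF lam], rule finite_sum_le_infsum[OF summable]) simp_all
    have pw: "(x * \<bar>lam\<bar> powr \<beta>) powr (1 / p) = x powr (1 / p) * \<bar>lam\<bar> powr \<gamma>" if "0 < x" for x
      using that assms(1) \<gamma>p[symmetric] by (simp add: powr_mult powr_powr)
    have pos: "0 < \<bar>lam\<bar> powr \<gamma>" using lam by simp
    have "c powr (1 / p) * \<bar>lam\<bar> powr \<gamma> \<le> Ap_norm p (?E lam)"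
      unfolding Ap_norm_def pw[OF c(1), symmetric] using lo c(1) assms(1) by (intro powr_mono2) auto
    moreover have "Ap_norm p (?E lam) \<le> C powr (1 / p) * \<bar>lam\<bar> powr \<gamma>"
      unfolding Ap_norm_def pw[OF C(1), symmetric] using up assms(1) by (intro powr_mono2 infsum_nonneg) auto
    ultimately show ?thesis
      using summable pos by (simp add: Ap_summable_def pos_le_divide_eq pos_divide_le_eq)
  qed
  have "\<forall>\<^sub>F lam in at_infinity. Ap_summable p (?E lam) \<and> c powr (1 / p) \<le> Ap_norm p (?E lam) / \<bar>lam\<bar> powr \<gamma>
      \<and> Ap_norm p (?E lam) / \<bar>lam\<bar> powr \<gamma> \<le> C powr (1 / p)"
    unfolding eventually_at_infinity by (rule exI[of _ 1]) (use bounds in auto)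
  then show ?thesis
    unfolding \<gamma>_def using c(1) C(1)
    by (intro exI[of _ "c powr (1 / p)"] exI[of _ "C powr (1 / p)"] conjI) auto
qed

end
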